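(* Let $\alpha\in(\frac13,\frac12]$, $T>0$, let $V,W,U$ be Banach spaces, let $\mathbf X=(1,X,\mathbb X)\in\mathcal D^\alpha(\Delta_T,V)$ and $\mathbf Z=(Z,Z')\in\mathcal C^\alpha_{\mathbf X}([0,T],W)$. For $0\le s\le t\le T$ define $$\mathbb Z_{s,t}:=\int_s^tZ_{s,u}\otimes dZ_u:=\lim_{|\pi|\to0}\sum_{[u,v]\in\pi}\Big(Z_{s,u}\otimes Z_{u,v}+(Z'_u\otimes Z'_u)\mathbb X_{u,v}\Big)\in W\otimes W,$$ where $\pi$ runs over partitions of $[s,t]$. Then $\widehat{\mathbf Z}:=(1,Z,\mathbb Z)$ (with first level the increments $Z_{s,t}$) is a level-2 $\alpha$-Hölder rough path over $W$, i.e. $\widehat{\mathbf Z}\in\mathcal D^\alpha(\Delta_T,W)$, and $$\|\widehat{\mathbf Z}\|_\alpha\le M\big(T,\|\mathbf X\|_\alpha,|Z'_0|,\|\mathbf Z\|_{\mathbf X;\alpha}\big)$$ for a universal function $M$ increasing in all of its arguments. Furthermore, let $F\in C^3_b(U,\mathcal L(W,U))$. Then a $U$-valued path $Y$ solves $$Y_t=Y_0+\int_0^tF(Y_u)\,d\mathbf Z_u,\quad t\in[0,T],$$ in the controlled-driven sense if and only if $Y$ solves the classical rough differential equation driven by the rough path $\widehat{\mathbf Z}$, $$Y_t=Y_0+\int_0^tF(Y_u)\,d\widehat{\mathbf Z}_u,\quad t\in[0,T].$$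
   Context: All Banach spaces are real; tensor products of Banach spaces carry a fixed admissible cross norm and are completed (for definiteness one may take the projective tensor norm throughout). $\mathcal L(A,B)$ is the space of bounded linear maps. For a path $X$, $X_{s,t}:=X_t-X_s$. $\Delta_T:=\{(s,t):0\le s\le t\le T\}$. $C^m_b(A,B)$ is the space of $m$ times continuously differentiable maps $F:A\to B$ with $\|F\|_\infty+\|DF\|_\infty+\dots+\|D^mF\|_\infty<\infty$. "Universal function $M$" means: a function of the displayed arguments, increasing in each, not depending on the data ($\mathbf X,\mathbf Z$) other than through those arguments ($\alpha$ is fixed). Rough path: for $\alpha\in(\frac13,\frac12]$ and a Banach space $V$, $\mathbf X=(1,X,\mathbb X):\Delta_T\to\mathbb R\oplus V\oplus V^{\otimes2}$ belongs to $\mathcal D^\alpha(\Delta_T,V)$ if Chen's relation holds, i.e. $X_{s,t}=X_{s,u}+X_{u,t}$ and $\mathbb X_{s,t}=\mathbb X_{s,u}+\mathbb X_{u,t}+X_{s,u}\otimes X_{u,t}$ for $s\le u\le t$, and $\|X\|_\alpha:=\sup_{s\ne t}\frac{|X_{s,t}|}{|t-s|^\alpha}<\infty$, $\|\mathbb X\|_{2\alpha}:=\sup_{s\neq t}\frac{|\mathbb X_{s,t}|}{|t-s|^{2\alpha}}<\infty$. Set $\|\mathbf X\|_\alpha:=\|X\|_\alpha+\|\mathbb X\|_{2\alpha}$. Controlled rough path: for $\mathbf X\in\mathcal D^\alpha(\Delta_T,V)$ and a Banach space $E$, $\mathcal C^\alpha_{\mathbf X}([0,T],E)$ is the set of $\mathbf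 Y=(Y,Y'):[0,T]\to E\times\mathcal L(V,E)$ such that, with $R^{0,\mathbf Y}_{s,t}:=Y_{s,t}-Y'_sX_{s,t}$ and $R^{1,\mathbf Y}_{s,t}:=Y'_t-Y'_s$, one has $\|R^{0,\mathbf Y}\|_{2\alpha}:=\sup_{s\ne t}\frac{|R^{0,\mathbf Y}_{s,t}|}{|t-s|^{2\alpha}}<\infty$ and $\|R^{1,\mathbf Y}\|_{\alpha}:=\sup_{s\ne t}\frac{|R^{1,\mathbf Y}_{s,t}|}{|t-s|^{\alpha}}<\infty$. Seminorm: $\|\mathbf Y\|_{\mathbf X;\alpha}:=\|R^{0,\mathbf Y}\|_{2\alpha}+\|R^{1,\mathbf Y}\|_\alpha$. Controlled rough integral: for $\mathbf G=(G,G')$ $\mathbf X$-controlled with values in $\mathcal L(W,E)$ and $\mathbf Z$ $\mathbf X$-controlled with values in $W$, $\int_s^tG_r\,d\mathbf Z_r:=\lim_{|\pi|\to0}\sum_{[u,v]\in\pi}\big(G_uZ_{u,v}+G'_uZ'_u\mathbb X_{u,v}\big)\in E$, over partitions $\pi$ of $[s,t]$ (this limit is known to exist), where $G'_uZ'_u$ acts on $V\otimes V$ as the linear extension of $x_1\otimes x_2\mapsto[G'_u(x_1)](Z'_u(x_2))$. The limit defining $\mathbb Z_{s,t}$ is the special case $\mathbb Z_{s,t}=\int_s^tL^s_u\,d\mathbf Z_u$, where, for $u\in[s,T]$, $L^s_u\in\mathcal L(W,W\otimes W)$, $L^s_u(w)=Z_{s,u}\otimes w$, with derivative $(L^s)'_u(\xi)(w)=Z'_u(\xi)\otimes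 w$ for $\xi\in V$. Solution in the controlled-driven sense: $(Y,Y')\in\mathcal C^\alpha_{\mathbf X}([0,T],U)$ with $Y'_t=F(Y_t)Z'_t$ and $Y_t=Y_0+\int_0^tF(Y_u)\,d\mathbf Z_u$, where the integrand is the controlled path $(F(Y),DF(Y)Y')$. Classical solution driven by $\widehat{\mathbf Z}$: $(Y,F(Y))\in\mathcal C^\alpha_{\widehat{\mathbf Z}}([0,T],U)$ (i.e. $Y$ is controlled by $\widehat{\mathbf Z}$ with Gubinelli derivative $F(Y)$) and $Y_t=Y_0+\int_0^tF(Y_u)\,d\widehat{\mathbf Z}_u$, where $\int_s^tF(Y_u)\,d\widehat{\mathbf Z}_u:=\lim_{|\pi|\to0}\sum_{[u,v]\in\pi}\big(F(Y_u)Z_{u,v}+DF(Y_u)F(Y_u)\mathbb Z_{u,v}\big)$ and $DF(y)F(y)$ acts on $W\otimes W$ as the linear extension of $w_1\otimes w_2\mapsto[DF(y)(F(y)w_1)](w_2)$. *)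

theory Defs
  imports "HOL-Analysis.Analysis"
begin

section \<open>Completed projective tensor products\<close>

text \<open>
  \<open>projective_tensor tens\<close> says that the Banach space \<open>'c\<close>, together with the map
  \<open>tens\<close> (written \<open>x \<otimes> y\<close> below), is the completed projective tensor product of \<open>'a\<close> and \<open>'b\<close>:
  the elementary tensors span a copy of the algebraic tensor product (the first two conjuncts; the
  second is the universal property of the algebraic tensor product, for which real-valued bilinear
  forms suffice because linear functionals separate the points of any vector space), the norm on
  this span is the projective tensor norm
  \<open>inf {\<Sum>\<^sub>i |x\<^sub>i| |y\<^sub>i| : p = \<Sum>\<^sub>i x\<^sub>i \<otimes> y\<^sub>i}\<close>, and the span is dense in the complete space \<open>'c\<close>.
  These conditions determine \<open>'c\<close> and \<open>tens\<close> up to isometric isomorphism. In the second conjunct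
  neither \<open>B\<close> nor \<open>L\<close> is required to be bounded.
\<close>

definition projective_tensor :: "('a::banach \<Rightarrow> 'b::banach \<Rightarrow> 'c::banach) \<Rightarrow> bool" where
  "projective_tensor tens \<longleftrightarrow>
     bilinear tens \<and>
     (\<forall>B :: 'a \<Rightarrow> 'b \<Rightarrow> real. bilinear B \<longrightarrow>
        (\<exists>L :: 'c \<Rightarrow> real. linear L \<and> (\<forall>x y. L (tens x y) = B x y))) \<and>
     (\<forall>p \<in> span {tens x y | x y. True}.
        norm p = Inf {(\<Sum>(x, y)\<leftarrow>xys. norm x * norm y) | xys. (\<Sum>(x, y)\<leftarrow>xys. tens x y) = p}) \<and>
     closure (span {tens x y | x y. True}) = UNIV"

text \<open>The continuous linear extension of \<open>x \<otimes> y \<mapsto> B x y\<close>.\<close>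

definition tensor_ext ::
    "('a::banach \<Rightarrow> 'b::banach \<Rightarrow> 'c::banach) \<Rightarrow> ('a \<Rightarrow> 'b \<Rightarrow> 'e::banach) \<Rightarrow> 'c \<Rightarrow>\<^sub>L 'e" where
  "tensor_ext tens B = (THE L. \<forall>x y. blinfun_apply L (tens x y) = B x y)"

section \<open>Rough paths and controlled rough paths\<close>

text \<open>
  Paths on \<open>[0,T]\<close> and two-parameter functions on \<open>\<Delta>\<^sub>T\<close> are total functions on the reals of which
  only the values on \<open>[0,T]\<close> resp. \<open>\<Delta>\<^sub>T\<close> are used.
\<close>

definition holder_quotients :: "real \<Rightarrow> real \<Rightarrow> (real \<Rightarrow> real \<Rightarrow> 'a::real_normed_vector) \<Rightarrow> real set" where
  "holder_quotients T \<gamma> A = {norm (A s t) / (t - s) powr \<gamma> | s t. 0 \<le> s \<and> s < t \<and> t \<le> T}"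

definition holder_finite :: "real \<Rightarrow> real \<Rightarrow> (real \<Rightarrow> real \<Rightarrow> 'a::real_normed_vector) \<Rightarrow> bool" where
  "holder_finite T \<gamma> A \<longleftrightarrow> bdd_above (holder_quotients T \<gamma> A)"

definition holder_norm :: "real \<Rightarrow> real \<Rightarrow> (real \<Rightarrow> real \<Rightarrow> 'a::real_normed_vector) \<Rightarrow> real" where
  "holder_norm T \<gamma> A = Sup (holder_quotients T \<gamma> A)"

text \<open>
  A level-2 rough path \<open>(1, X, XX)\<close> is given by its two nontrivial components; \<open>tens\<close> is the
  tensor product in which \<open>XX\<close> takes its values.
\<close>

definition rough_path :: "('v::banach \<Rightarrow> 'v \<Rightarrow> 'vv::banach) \<Rightarrow> real \<Rightarrow> real \<Rightarrow>
    (real \<Rightarrow> real \<Rightarrow> 'v) \<Rightarrow> (real \<Rightarrow> real \<Rightarrow> 'vv) \<Rightarrow> bool" where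
  "rough_path tens \<alpha> T X XX \<longleftrightarrow>
     (\<forall>s u t. 0 \<le> s \<and> s \<le> u \<and> u \<le> t \<and> t \<le> T \<longrightarrow>
        X s t = X s u + X u t \<and>
        XX s t = XX s u + XX u t + tens (X s u) (X u t)) \<and>
     holder_finite T \<alpha> X \<and> holder_finite T (2 * \<alpha>) XX"

definition rough_norm :: "real \<Rightarrow> real \<Rightarrow>
    (real \<Rightarrow> real \<Rightarrow> 'v::banach) \<Rightarrow> (real \<Rightarrow> real \<Rightarrow> 'vv::banach) \<Rightarrow> real" where
  "rough_norm \<alpha> T X XX = holder_norm T \<alpha> X + holder_norm T (2 * \<alpha>) XX"

definition increments :: "(real \<Rightarrow> 'a::banach) \<Rightarrow> real \<Rightarrow> real \<Rightarrow> 'a" where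
  "increments Y s t = Y t - Y s"

definition remainder0 :: "(real \<Rightarrow> real \<Rightarrow> 'v::banach) \<Rightarrow>
    (real \<Rightarrow> 'e::banach) \<Rightarrow> (real \<Rightarrow> 'v \<Rightarrow>\<^sub>L 'e) \<Rightarrow> real \<Rightarrow> real \<Rightarrow> 'e" where
  "remainder0 X Y Y' s t = increments Y s t - blinfun_apply (Y' s) (X s t)"

definition controlled :: "real \<Rightarrow> real \<Rightarrow> (real \<Rightarrow> real \<Rightarrow> 'v::banach) \<Rightarrow>
    (real \<Rightarrow> 'e::banach) \<Rightarrow> (real \<Rightarrow> 'v \<Rightarrow>\<^sub>L 'e) \<Rightarrow> bool" where
  "controlled \<alpha> T X Y Y' \<longleftrightarrow>
     holder_finite T (2 * \<alpha>) (remainder0 X Y Y') \<and> holder_finite T \<alpha> (increments Y')"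

definition controlled_norm :: "real \<Rightarrow> real \<Rightarrow> (real \<Rightarrow> real \<Rightarrow> 'v::banach) \<Rightarrow>
    (real \<Rightarrow> 'e::banach) \<Rightarrow> (real \<Rightarrow> 'v \<Rightarrow>\<^sub>L 'e) \<Rightarrow> real" where
  "controlled_norm \<alpha> T X Y Y' =
     holder_norm T (2 * \<alpha>) (remainder0 X Y Y') + holder_norm T \<alpha> (increments Y')"

section \<open>Limits of sums over partitions\<close>

text \<open>
  A partition of \<open>[s,t]\<close> is the list of its points \<open>s = r\<^sub>0 < \<dots> < r\<^sub>n = t\<close>; for \<open>s = t\<close> the only
  one is \<open>[s]\<close>, with empty sum.
\<close>

definition partitions :: "real \<Rightarrow> real \<Rightarrow> real list set" where
  "partitions s t = {ps. ps \<noteq> [] \<and> sorted_wrt (<) ps \<and> hd ps = s \<and> last ps = t}"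

definition mesh_below :: "real \<Rightarrow> real list \<Rightarrow> bool" where
  "mesh_below \<delta> ps \<longleftrightarrow> (\<forall>i. Suc i < length ps \<longrightarrow> ps ! Suc i - ps ! i < \<delta>)"

definition mesh_to_0 :: "real \<Rightarrow> real \<Rightarrow> real list filter" where
  "mesh_to_0 s t = (INF \<delta>\<in>{0<..}. principal {ps \<in> partitions s t. mesh_below \<delta> ps})"

definition partition_sum :: "(real \<Rightarrow> real \<Rightarrow> 'a::banach) \<Rightarrow> real list \<Rightarrow> 'a" where
  "partition_sum A ps = (\<Sum>i<length ps - 1. A (ps ! i) (ps ! Suc i))"

definition has_partition_limit ::
    "(real \<Rightarrow> real \<Rightarrow> 'a::banach) \<Rightarrow> 'a \<Rightarrow> real \<Rightarrow> real \<Rightarrow> bool" where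
  "has_partition_limit A I s t \<longleftrightarrow> (partition_sum A \<longlongrightarrow> I) (mesh_to_0 s t)"

definition partition_limit :: "(real \<Rightarrow> real \<Rightarrow> 'a::banach) \<Rightarrow> real \<Rightarrow> real \<Rightarrow> 'a" where
  "partition_limit A s t = Lim (mesh_to_0 s t) (partition_sum A)"

section \<open>The lifted rough path\<close>

text \<open>The summand \<open>Z\<^sub>s\<^sub>,\<^sub>u \<otimes> Z\<^sub>u\<^sub>,\<^sub>v + (Z'\<^sub>u \<otimes> Z'\<^sub>u) XX\<^sub>u\<^sub>,\<^sub>v\<close>, and its limit \<open>ZZ\<^sub>s\<^sub>,\<^sub>t\<close>.\<close>

definition lift_germ :: "('v::banach \<Rightarrow> 'v \<Rightarrow> 'vv::banach) \<Rightarrow> ('w::banach \<Rightarrow> 'w \<Rightarrow> 'ww::banach) \<Rightarrow>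
    (real \<Rightarrow> real \<Rightarrow> 'vv) \<Rightarrow> (real \<Rightarrow> 'w) \<Rightarrow> (real \<Rightarrow> 'v \<Rightarrow>\<^sub>L 'w) \<Rightarrow> real \<Rightarrow> real \<Rightarrow> real \<Rightarrow> 'ww" where
  "lift_germ tensV tensW XX Z Z' s u v =
     tensW (increments Z s u) (increments Z u v) +
     blinfun_apply (tensor_ext tensV (\<lambda>x1 x2. tensW (blinfun_apply (Z' u) x1) (blinfun_apply (Z' u) x2)))
       (XX u v)"

definition lift2 :: "('v::banach \<Rightarrow> 'v \<Rightarrow> 'vv::banach) \<Rightarrow> ('w::banach \<Rightarrow> 'w \<Rightarrow> 'ww::banach) \<Rightarrow>
    (real \<Rightarrow> real \<Rightarrow> 'vv) \<Rightarrow> (real \<Rightarrow> 'w) \<Rightarrow> (real \<Rightarrow> 'v \<Rightarrow>\<^sub>L 'w) \<Rightarrow> real \<Rightarrow> real \<Rightarrow> 'ww" where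
  "lift2 tensV tensW XX Z Z' s t = partition_limit (lift_germ tensV tensW XX Z Z' s) s t"

section \<open>Differential equations\<close>

definition fderiv :: "('a::banach \<Rightarrow> 'b::banach) \<Rightarrow> 'a \<Rightarrow> 'a \<Rightarrow>\<^sub>L 'b" where
  "fderiv F y = Blinfun (frechet_derivative F (at y))"

definition C3b :: "('a::banach \<Rightarrow> 'b::banach) \<Rightarrow> bool" where
  "C3b F \<longleftrightarrow>
     (\<forall>y. F differentiable (at y)) \<and>
     (\<forall>y. fderiv F differentiable (at y)) \<and>
     (\<forall>y. fderiv (fderiv F) differentiable (at y)) \<and>
     continuous_on UNIV (fderiv (fderiv (fderiv F))) \<and>
     bounded (range F) \<and> bounded (range (fderiv F)) \<and>
     bounded (range (fderiv (fderiv F))) \<and> bounded (range (fderiv (fderiv (fderiv F))))"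

text \<open>
  The summand \<open>G\<^sub>u Z\<^sub>u\<^sub>,\<^sub>v + G'\<^sub>u Z'\<^sub>u XX\<^sub>u\<^sub>,\<^sub>v\<close> of the integral of a controlled path \<open>(G, G')\<close> against a
  controlled path \<open>(Z, Z')\<close>.
\<close>

definition controlled_germ :: "('v::banach \<Rightarrow> 'v \<Rightarrow> 'vv::banach) \<Rightarrow> (real \<Rightarrow> real \<Rightarrow> 'vv) \<Rightarrow>
    (real \<Rightarrow> 'w::banach) \<Rightarrow> (real \<Rightarrow> 'v \<Rightarrow>\<^sub>L 'w) \<Rightarrow>
    (real \<Rightarrow> 'w \<Rightarrow>\<^sub>L 'e::banach) \<Rightarrow> (real \<Rightarrow> 'v \<Rightarrow>\<^sub>L 'w \<Rightarrow>\<^sub>L 'e) \<Rightarrow> real \<Rightarrow> real \<Rightarrow> 'e" where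
  "controlled_germ tensV XX Z Z' G G' u v =
     blinfun_apply (G u) (increments Z u v) +
     blinfun_apply
       (tensor_ext tensV (\<lambda>x1 x2. blinfun_apply (blinfun_apply (G' u) x1) (blinfun_apply (Z' u) x2)))
       (XX u v)"

text \<open>
  In both notions of solution the equation \<open>Y\<^sub>t = Y\<^sub>0 + \<integral>\<^sub>0\<^sup>t \<dots>\<close> is understood to include that the
  limit defining the integral exists.
\<close>

definition controlled_solution :: "('v::banach \<Rightarrow> 'v \<Rightarrow> 'vv::banach) \<Rightarrow> real \<Rightarrow> real \<Rightarrow>
    (real \<Rightarrow> real \<Rightarrow> 'v) \<Rightarrow> (real \<Rightarrow> real \<Rightarrow> 'vv) \<Rightarrow> (real \<Rightarrow> 'w::banach) \<Rightarrow> (real \<Rightarrow> 'v \<Rightarrow>\<^sub>L 'w) \<Rightarrow>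
    ('u::banach \<Rightarrow> 'w \<Rightarrow>\<^sub>L 'u) \<Rightarrow> (real \<Rightarrow> 'u) \<Rightarrow> (real \<Rightarrow> 'v \<Rightarrow>\<^sub>L 'u) \<Rightarrow> bool" where
  "controlled_solution tensV \<alpha> T X XX Z Z' F Y Y' \<longleftrightarrow>
     controlled \<alpha> T X Y Y' \<and>
     (\<forall>t\<in>{0..T}. Y' t = F (Y t) o\<^sub>L Z' t) \<and>
     (\<forall>t\<in>{0..T}. \<exists>I. has_partition_limit
        (controlled_germ tensV XX Z Z' (\<lambda>u. F (Y u)) (\<lambda>u. fderiv F (Y u) o\<^sub>L Y' u)) I 0 t \<and>
        Y t = Y 0 + I)"

text \<open>
  The classical equation driven by a rough path \<open>(1, Z, ZZ)\<close>; here \<open>Z\<close> is the two-parameter first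
  level.
\<close>

definition rde_germ :: "('w::banach \<Rightarrow> 'w \<Rightarrow> 'ww::banach) \<Rightarrow>
    (real \<Rightarrow> real \<Rightarrow> 'w) \<Rightarrow> (real \<Rightarrow> real \<Rightarrow> 'ww) \<Rightarrow>
    ('u::banach \<Rightarrow> 'w \<Rightarrow>\<^sub>L 'u) \<Rightarrow> (real \<Rightarrow> 'u) \<Rightarrow> real \<Rightarrow> real \<Rightarrow> 'u" where
  "rde_germ tensW Z ZZ F Y u v =
     blinfun_apply (F (Y u)) (Z u v) +
     blinfun_apply
       (tensor_ext tensW (\<lambda>w1 w2.
          blinfun_apply (blinfun_apply (fderiv F (Y u)) (blinfun_apply (F (Y u)) w1)) w2))
       (ZZ u v)"

definition rde_solution :: "('w::banach \<Rightarrow> 'w \<Rightarrow> 'ww::banach) \<Rightarrow> real \<Rightarrow> real \<Rightarrow>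
    (real \<Rightarrow> real \<Rightarrow> 'w) \<Rightarrow> (real \<Rightarrow> real \<Rightarrow> 'ww) \<Rightarrow>
    ('u::banach \<Rightarrow> 'w \<Rightarrow>\<^sub>L 'u) \<Rightarrow> (real \<Rightarrow> 'u) \<Rightarrow> bool" where
  "rde_solution tensW \<alpha> T Z ZZ F Y \<longleftrightarrow>
     controlled \<alpha> T Z Y (\<lambda>t. F (Y t)) \<and>
     (\<forall>t\<in>{0..T}. \<exists>I. has_partition_limit (rde_germ tensW Z ZZ F Y) I 0 t \<and> Y t = Y 0 + I)"

end

(* Write Z(s,t) for the increment of Z. The defect over u <= m <= v of the germ
   Z(s,u) (x) Z(u,v) + (Z'_u (x) Z'_u) XX(u,v) does not depend on s, and Chen's relation for XX together
   with the controlledness of Z makes it O(|v-u|^(3 alpha)). Since 3 alpha > 1, the sewing lemma yields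
   the limit ZZ(s,t) and ZZ(s,t) = (Z'_s (x) Z'_s) XX(s,t) + O(|t-s|^(3 alpha)), with a constant that
   depends only on the size of the data. Changing the base point s alters the germ by an additive term,
   which gives Chen's relation for ZZ. By the same expansion of ZZ the germs of the two equations differ
   by O(|v-u|^(3 alpha)), so their partition sums have the same limits. *)
theory Submission
  imports Defs
begin

section \<open>Sums over partitions\<close>

text \<open>Three points shape the proof. The limits run over all partitions of vanishing mesh, not
  along refinements of one sequence, so sewing has to compare two unrelated fine partitions; this
  goes through their common refinement and an estimate over a single interval that is uniform in the
  partition. Next, \<open>tensor_ext\<close> is a definite description and
  \<open>projective_tensor\<close> offers only scalar functionals on the algebraic tensor product;
  vector-valued bilinear maps must first be shown to extend, with control of the constant, before
  second-level terms can be estimated. Finally, in the equivalence the integrals along Y are never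
  constructed: existence and value of the limit pass from one equation to the other. What remains is
  to turn control of Y by X with derivative F(Y) Z' into control by Z with derivative F(Y), and
  back. The expansion of Z along X carries the remainders across; Hoelder continuity of the
  derivative comes from the Lipschitz bound on F in one direction and from that of F(Y) and Z' in
  the other.\<close>

lemma partition_sum_singleton [simp]: "partition_sum A [x] = 0"
  by (simp add: partition_sum_def)

lemma partition_sum_Cons: "partition_sum A (x # y # ps) = A x y + partition_sum A (y # ps)"
  unfolding partition_sum_def by (simp add: sum.lessThan_Suc_shift del: sum.lessThan_Suc)

lemma partition_sum_append:
  "partition_sum A (xs @ y # ys) = partition_sum A (xs @ [y]) + partition_sum A (y # ys)"
proof (induction xs)
  case (Cons x xs)
  then show ?case
    by (cases xs) (simp_all add: partition_sum_Cons add.assoc)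
qed simp

lemma partition_sum_add:
  "partition_sum (\<lambda>u v. A u v + B u v) ps = partition_sum A ps + partition_sum B ps"
  unfolding partition_sum_def by (rule sum.distrib)

lemma partition_sum_increments:
  "ps \<noteq> [] \<Longrightarrow> partition_sum (\<lambda>u v. f v - f u) ps = f (last ps) - f (hd ps)"
proof (induction ps)
  case (Cons x ps)
  then show ?case
    by (cases ps) (simp_all add: partition_sum_Cons)
qed simp

section \<open>Splitting and gluing of partitions, mesh, and estimates of partition sums\<close>

lemma partitions_append:
  "xs @ y # ys \<in> partitions s t \<longleftrightarrow> xs @ [y] \<in> partitions s y \<and> y # ys \<in> partitions y t"
proof
  assume "xs @ y # ys \<in> partitions s t"
  then show "xs @ [y] \<in> partitions s y \<and> y # ys \<in> partitions y t"
    by (cases xs) (auto simp: partitions_def sorted_wrt_append)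
next
  assume "xs @ [y] \<in> partitions s y \<and> y # ys \<in> partitions y t"
  then show "xs @ y # ys \<in> partitions s t"
    by (cases xs) (auto simp: partitions_def sorted_wrt_append intro: less_trans)
qed

lemma partitions_bounds:
  assumes "ps \<in> partitions s t" "x \<in> set ps"
  shows "s \<le> x" "x \<le> t"
proof -
  obtain xs ys where ps: "ps = xs @ x # ys"
    using assms(2) by (auto dest: split_list)
  show "s \<le> x" using assms(1) unfolding ps
    by (cases xs) (auto simp: partitions_def)
  show "x \<le> t" using assms(1) unfolding ps
    by (cases ys rule: rev_cases) (auto simp: partitions_def sorted_wrt_append)
qed

lemma partitions_le:
  assumes "ps \<in> partitions s t"
  shows "s \<le> t"
proof -
  have "s \<in> set ps" using assms hd_in_set by (auto simp: partitions_def)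
  then show ?thesis using partitions_bounds(2)[OF assms] by blast
qed

lemma partitions_Cons:
  assumes "x # r # ps \<in> partitions s t"
  shows "x = s" "s < r" "r \<le> t" "r # ps \<in> partitions r t"
proof -
  have "[x] @ [r] \<in> partitions s r \<and> r # ps \<in> partitions r t"
    using assms by (subst partitions_append[symmetric]) simp
  then show "r # ps \<in> partitions r t" "x = s" "s < r" "r \<le> t"
    using partitions_le[of "r # ps" r t] by (auto simp: partitions_def)
qed

lemma partitions_trivial:
  assumes "ps \<in> partitions s s"
  shows "ps = [s]"
proof (cases ps)
  case Nil
  with assms show ?thesis by (simp add: partitions_def)
next
  case (Cons x qs)
  with assms show ?thesis
    using partitions_Cons(2,3)[of x "hd qs" "tl qs" s s] by (cases qs) (auto simp: partitions_def)
qed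

lemma mesh_below_Cons:
  "mesh_below \<delta> (x # y # ps) \<longleftrightarrow> y - x < \<delta> \<and> mesh_below \<delta> (y # ps)"
proof -
  have split: "(\<forall>i. P i) \<longleftrightarrow> P 0 \<and> (\<forall>i. P (Suc i))" for P :: "nat \<Rightarrow> bool"
    by (metis not0_implies_Suc)
  show ?thesis
    unfolding mesh_below_def by (subst split) simp
qed

lemma mesh_below_singleton [simp]: "mesh_below \<delta> [x]"
  by (simp add: mesh_below_def)

lemma mesh_below_append:
  "mesh_below \<delta> (xs @ y # ys) \<longleftrightarrow> mesh_below \<delta> (xs @ [y]) \<and> mesh_below \<delta> (y # ys)"
proof (induction xs)
  case (Cons x xs)
  then show ?case
    by (cases xs) (simp_all add: mesh_below_Cons)
qed simp

lemma norm_partition_sum_le: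
  assumes "ps \<in> partitions s t"
    and "\<And>u v. s \<le> u \<Longrightarrow> u < v \<Longrightarrow> v \<le> t \<Longrightarrow> norm (A u v) \<le> B u v"
  shows "norm (partition_sum A ps) \<le> partition_sum B ps"
  unfolding partition_sum_def
proof (rule sum_norm_le)
  fix i assume "i \<in> {..<length ps - 1}"
  then have i: "Suc i < length ps" by auto
  then have "ps ! i < ps ! Suc i"
    using assms(1) by (auto simp: partitions_def sorted_wrt_iff_nth_less)
  then show "norm (A (ps ! i) (ps ! Suc i)) \<le> B (ps ! i) (ps ! Suc i)"
    using partitions_bounds[OF assms(1)] i by (intro assms(2)) auto
qed

text \<open>Of each \<open>(v - u) powr \<theta>\<close> the factor
  \<open>(v - u) powr (\<theta> - 1)\<close> is absorbed by the mesh, and the remaining lengths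
  telescope to t - s. This is how \<theta> > 1 makes errors vanish.\<close>

lemma partition_sum_powr_le:
  assumes "ps \<in> partitions s t" "mesh_below \<delta> ps" "1 < \<theta>" "0 \<le> K"
  shows "partition_sum (\<lambda>u v. K * (v - u) powr \<theta>) ps \<le> K * \<delta> powr (\<theta> - 1) * (t - s)"
proof -
  have "partition_sum (\<lambda>u v. K * (v - u) powr \<theta>) ps \<le>
      partition_sum (\<lambda>u v. K * \<delta> powr (\<theta> - 1) * v - K * \<delta> powr (\<theta> - 1) * u) ps"
    unfolding partition_sum_def
  proof (rule sum_mono)
    fix i assume "i \<in> {..<length ps - 1}"
    then have i: "Suc i < length ps" by auto
    then have lt: "ps ! i < ps ! Suc i"
      using assms(1) by (auto simp: partitions_def sorted_wrt_iff_nth_less)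
    have "ps ! Suc i - ps ! i < \<delta>"
      using i assms(2) by (auto simp: mesh_below_def)
    then have "(ps ! Suc i - ps ! i) powr (\<theta> - 1) * (ps ! Suc i - ps ! i)
        \<le> \<delta> powr (\<theta> - 1) * (ps ! Suc i - ps ! i)"
      using lt assms(3) by (intro mult_right_mono powr_mono2) auto
    moreover have "(ps ! Suc i - ps ! i) powr (\<theta> - 1) * (ps ! Suc i - ps ! i)
        = (ps ! Suc i - ps ! i) powr \<theta>"
      using lt by (simp add: powr_diff)
    ultimately show "K * (ps ! Suc i - ps ! i) powr \<theta>
        \<le> K * \<delta> powr (\<theta> - 1) * ps ! Suc i - K * \<delta> powr (\<theta> - 1) * ps ! i"
      using assms(4) by (metis mult.assoc mult_left_mono right_diff_distrib)
  qed
  also have "\<dots> = K * \<delta> powr (\<theta> - 1) * (t - s)"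
    using assms(1) by (subst partition_sum_increments) (auto simp: partitions_def algebra_simps)
  finally show ?thesis .
qed

text \<open>Serves both to show that \<open>mesh_to_0\<close> is a proper filter and to pick test
  partitions. Steps of length \<delta>/2 followed by a shorter one respect the strict inequality in
  \<open>mesh_below\<close>.\<close>

lemma partitions_fine:
  assumes "s \<le> t" "0 < \<delta>"
  shows "\<exists>ps \<in> partitions s t. mesh_below \<delta> ps"
proof -
  have "\<forall>s. s \<le> t \<longrightarrow> t - s \<le> real n * (\<delta> / 2) \<longrightarrow> (\<exists>ps \<in> partitions s t. mesh_below \<delta> ps)" for n
  proof (induction n)
    case 0
    have "[t] \<in> partitions t t" by (simp add: partitions_def)
    then show ?case by (auto intro!: bexI[of _ "[t]"])
  next
    case (Suc n)
    show ?case
    proof (intro allI impI)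
      fix s assume st: "s \<le> t" "t - s \<le> real (Suc n) * (\<delta> / 2)"
      show "\<exists>ps \<in> partitions s t. mesh_below \<delta> ps"
      proof (cases "s + \<delta> / 2 \<le> t")
        case True
        then obtain ps where ps: "ps \<in> partitions (s + \<delta> / 2) t" "mesh_below \<delta> ps"
          using Suc st by (fastforce simp: algebra_simps)
        then obtain qs where "ps = (s + \<delta> / 2) # qs"
          by (cases ps) (auto simp: partitions_def)
        with ps assms(2) have "s # ps \<in> partitions s t" "mesh_below \<delta> (s # ps)"
          using partitions_append[of "[s]" "s + \<delta> / 2" qs s t]
          by (auto simp: mesh_below_Cons) (auto simp: partitions_def)
        then show ?thesis by blast
      next
        case False
        show ?thesis
        proof (cases "s = t")
          case True
          then show ?thesis by (intro bexI[of _ "[t]"]) (auto simp: partitions_def)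
        next
          case neq: False
          show ?thesis
            by (rule bexI[of _ "[s, t]"]) (use False st neq in \<open>auto simp: partitions_def mesh_below_Cons\<close>)
        qed
      qed
    qed
  qed
  moreover obtain n where "(t - s) / (\<delta> / 2) \<le> real n"
    using real_arch_simple by blast
  ultimately show ?thesis
    using assms by (force simp: field_simps)
qed

section \<open>Convergence along partitions of vanishing mesh\<close>

lemma eventually_mesh_to_0:
  "eventually P (mesh_to_0 s t) \<longleftrightarrow> (\<exists>\<delta>>0. \<forall>ps \<in> partitions s t. mesh_below \<delta> ps \<longrightarrow> P ps)"
proof -
  have "eventually P (mesh_to_0 s t) \<longleftrightarrow>
    (\<exists>\<delta>\<in>{0<..}. eventually P (principal {ps \<in> partitions s t. mesh_below \<delta> ps}))"
    unfolding mesh_to_0_def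
  proof (rule eventually_INF_base)
    fix a b :: real assume ab: "a \<in> {0<..}" "b \<in> {0<..}"
    show "\<exists>x\<in>{0<..}. principal {ps \<in> partitions s t. mesh_below x ps}
        \<le> inf (principal {ps \<in> partitions s t. mesh_below a ps})
          (principal {ps \<in> partitions s t. mesh_below b ps})"
      by (rule bexI[of _ "min a b"]) (use ab in \<open>auto simp: mesh_below_def\<close>)
  qed auto
  then show ?thesis
    by (auto simp: eventually_principal)
qed

text \<open>Properness of the filter gives uniqueness of limits, so that the \<open>Lim\<close> in
  \<open>partition_limit\<close> equals any limit that has been found.\<close>

lemma mesh_to_0_neq_bot: "s \<le> t \<Longrightarrow> mesh_to_0 s t \<noteq> bot"
  unfolding trivial_limit_def eventually_mesh_to_0 using partitions_fine by blast

lemma has_partition_limit_iff: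
  "has_partition_limit A I s t \<longleftrightarrow>
    (\<forall>\<epsilon>>0. \<exists>\<delta>>0. \<forall>ps \<in> partitions s t. mesh_below \<delta> ps \<longrightarrow> norm (partition_sum A ps - I) < \<epsilon>)"
  unfolding has_partition_limit_def tendsto_iff eventually_mesh_to_0 dist_norm ..

lemma partition_limit_eqI:
  "has_partition_limit A I s t \<Longrightarrow> s \<le> t \<Longrightarrow> partition_limit A s t = I"
  unfolding has_partition_limit_def partition_limit_def
  by (rule tendsto_Lim[OF mesh_to_0_neq_bot])

lemma has_partition_limit_unique:
  "has_partition_limit A I s t \<Longrightarrow> has_partition_limit A J s t \<Longrightarrow> s \<le> t \<Longrightarrow> I = J"
  by (metis partition_limit_eqI)

lemma has_partition_limit_add:
  "has_partition_limit A I s t \<Longrightarrow> has_partition_limit B J s t \<Longrightarrow>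
    has_partition_limit (\<lambda>u v. A u v + B u v) (I + J) s t"
  unfolding has_partition_limit_def partition_sum_add by (rule tendsto_add)

lemma has_partition_limit_increments:
  "has_partition_limit (\<lambda>u v. f v - f u) (f t - f s) s t"
  unfolding has_partition_limit_iff
proof (intro allI impI exI[of _ 1] conjI ballI)
  fix \<epsilon> :: real and ps assume "0 < \<epsilon>" "ps \<in> partitions s t"
  then show "norm (partition_sum (\<lambda>u v. f v - f u) ps - (f t - f s)) < \<epsilon>"
    by (subst partition_sum_increments) (auto simp: partitions_def)
qed simp

text \<open>Since L is already a limit over all fine partitions of [s,t], it can be evaluated along
  those that pass through u, and these split into a partition of [s,u] and one of [u,t].\<close>

lemma has_partition_limit_combine:
  assumes I: "has_partition_limit A I s u" and J: "has_partition_limit A J u t"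
    and L: "has_partition_limit A L s t" and le: "s \<le> u" "u \<le> t"
  shows "L = I + J"
proof -
  have "norm (L - (I + J)) < \<epsilon>" if "0 < \<epsilon>" for \<epsilon>
  proof -
    have "0 < \<epsilon> / 3" using that by simp
    with I J L obtain d1 d2 d3 where d: "0 < d1" "0 < d2" "0 < d3"
      and d1: "\<And>ps. ps \<in> partitions s u \<Longrightarrow> mesh_below d1 ps \<Longrightarrow> norm (partition_sum A ps - I) < \<epsilon> / 3"
      and d2: "\<And>ps. ps \<in> partitions u t \<Longrightarrow> mesh_below d2 ps \<Longrightarrow> norm (partition_sum A ps - J) < \<epsilon> / 3"
      and d3: "\<And>ps. ps \<in> partitions s t \<Longrightarrow> mesh_below d3 ps \<Longrightarrow> norm (partition_sum A ps - L) < \<epsilon> / 3"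
      unfolding has_partition_limit_iff by metis
    define d where "d = min d1 (min d2 d3)"
    have "0 < d" using d by (simp add: d_def)
    then obtain ps qs where ps: "ps \<in> partitions s u" "mesh_below d ps"
      and qs: "qs \<in> partitions u t" "mesh_below d qs"
      using le partitions_fine by metis
    obtain xs where xs: "ps = xs @ [u]"
      using ps(1) by (cases ps rule: rev_cases) (auto simp: partitions_def)
    obtain ys where ys: "qs = u # ys"
      using qs(1) by (cases qs) (auto simp: partitions_def)
    have pq: "xs @ u # ys \<in> partitions s t" "mesh_below d (xs @ u # ys)"
      using ps qs partitions_append[of xs u ys s t] mesh_below_append[of d xs u ys]
      unfolding xs ys by auto
    have *: "mesh_below d rs \<Longrightarrow> mesh_below d1 rs \<and> mesh_below d2 rs \<and> mesh_below d3 rs" for rs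
      by (auto simp: mesh_below_def d_def)
    have "norm (partition_sum A ps - I) < \<epsilon> / 3" "norm (partition_sum A qs - J) < \<epsilon> / 3"
      "norm (partition_sum A ps + partition_sum A qs - L) < \<epsilon> / 3"
      using d1[of ps] d2[of qs] d3[OF pq(1)] ps qs pq(2) *
      partition_sum_append[of A xs u ys] by (auto simp: xs ys)
    then have "norm ((partition_sum A ps - I) + (partition_sum A qs - J)
       - (partition_sum A ps + partition_sum A qs - L)) < \<epsilon> / 3 + \<epsilon> / 3 + \<epsilon> / 3"
      by (smt (verit) norm_triangle_ineq norm_triangle_ineq4)
    then show ?thesis
      by (simp add: algebra_simps)
  qed
  then show ?thesis
    by (metis eq_iff_diff_eq_0 less_irrefl zero_less_norm_iff)
qed

lemma ex_mult_powr_less: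
  fixes C \<theta> \<epsilon> :: real
  assumes "1 < \<theta>" "0 < \<epsilon>"
  shows "\<exists>\<delta>>0. C * \<delta> powr (\<theta> - 1) < \<epsilon>"
proof -
  \<comment> \<open>The base tends to 0, which \<open>tendsto_powr'\<close> permits because the
    exponent is positive; the limit is 0 as \<open>0 powr x = 0\<close>.\<close>
  have "((\<lambda>\<delta>. C * \<delta> powr (\<theta> - 1)) \<longlongrightarrow> C * 0 powr (\<theta> - 1)) (at_right 0)"
    using assms(1) by (intro tendsto_intros tendsto_powr' ) (auto simp: eventually_at_filter)
  then have "eventually (\<lambda>\<delta>. C * \<delta> powr (\<theta> - 1) < \<epsilon>) (at_right 0)"
    using assms(2) by (intro order_tendstoD(2)) auto
  then obtain b where "0 < b" "\<And>\<delta>. 0 < \<delta> \<Longrightarrow> \<delta> < b \<Longrightarrow> C * \<delta> powr (\<theta> - 1) < \<epsilon>"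
    unfolding eventually_at_right_field by blast
  then show ?thesis
    by (intro exI[of _ "b / 2"]) auto
qed

text \<open>The sums of B - A are at most a constant times
  \<open>\<delta> powr (\<theta> - 1)\<close> and hence tend to 0; adding them to the sums of A
  gives those of B.\<close>

lemma has_partition_limit_close:
  assumes "has_partition_limit A I s t" "1 < \<theta>"
    and close: "\<And>u v. s \<le> u \<Longrightarrow> u < v \<Longrightarrow> v \<le> t \<Longrightarrow> norm (B u v - A u v) \<le> K * (v - u) powr \<theta>"
  shows "has_partition_limit B I s t"
proof -
  \<comment> \<open>K has no assumed sign, while \<open>partition_sum_powr_le\<close> asks for a
    nonnegative constant.\<close>
  define K' where "K' = max K 0"
  have "has_partition_limit (\<lambda>u v. B u v - A u v) 0 s t"
    unfolding has_partition_limit_iff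
  proof (intro allI impI)
    fix \<epsilon> :: real assume "0 < \<epsilon>"
    with assms(2) obtain \<delta> where \<delta>: "0 < \<delta>" "(K' * (t - s)) * \<delta> powr (\<theta> - 1) < \<epsilon>"
      using ex_mult_powr_less by blast
    show "\<exists>\<delta>>0. \<forall>ps\<in>partitions s t. mesh_below \<delta> ps \<longrightarrow>
        norm (partition_sum (\<lambda>u v. B u v - A u v) ps - 0) < \<epsilon>"
    proof (intro exI[of _ \<delta>] conjI ballI impI)
      fix ps assume ps: "ps \<in> partitions s t" "mesh_below \<delta> ps"
      have "norm (partition_sum (\<lambda>u v. B u v - A u v) ps)
          \<le> partition_sum (\<lambda>u v. K' * (v - u) powr \<theta>) ps"
      proof (rule norm_partition_sum_le[OF ps(1)])
        fix u v assume uv: "s \<le> u" "u < v" "v \<le> t"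
        show "norm (B u v - A u v) \<le> K' * (v - u) powr \<theta>"
          by (rule order_trans[OF close[OF uv]]) (auto simp: K'_def intro!: mult_right_mono)
      qed
      also have "\<dots> \<le> K' * \<delta> powr (\<theta> - 1) * (t - s)"
        by (rule partition_sum_powr_le[OF ps assms(2)]) (simp add: K'_def)
      finally show "norm (partition_sum (\<lambda>u v. B u v - A u v) ps - 0) < \<epsilon>"
        using \<delta> by (simp add: mult_ac)
    qed (use \<delta> in auto)
  qed
  from has_partition_limit_add[OF this assms(1)] show ?thesis
    by simp
qed

section \<open>The sewing lemma\<close>

locale almost_additive =
  fixes A :: "real \<Rightarrow> real \<Rightarrow> 'a::banach" and T K \<theta> :: real
  assumes theta: "1 < \<theta>" and K_nonneg: "0 \<le> K"
    and defect: "\<And>u m v. 0 \<le> u \<Longrightarrow> u \<le> m \<Longrightarrow> m \<le> v \<Longrightarrow> v \<le> T \<Longrightarrow>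
      norm (A u v - A u m - A m v) \<le> K * (v - u) powr \<theta>"
begin

text \<open>The solution C of C = 2 C (1/2)^\<theta> + 2 K: two pieces of at most half the length,
  plus two defects, reproduce the same bound in the induction below.\<close>

definition "sew_const = 2 / (1 - 2 powr (1 - \<theta>)) * K"

lemma sew_const_nonneg: "0 \<le> sew_const"
proof -
  have "2 powr (1 - \<theta>) < (2::real) powr 0"
    using theta by (intro powr_less_mono) auto
  then show ?thesis
    using K_nonneg by (simp add: sew_const_def)
qed

lemma sew_const_eq: "2 * (sew_const * (1 / 2) powr \<theta>) + 2 * K = sew_const"
proof -
  define q :: real where "q = 2 powr (1 - \<theta>)"
  have "q < 2 powr 0"
    unfolding q_def using theta by (intro powr_less_mono) auto
  then have "sew_const * q + 2 * K = sew_const"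
    by (simp add: sew_const_def q_def[symmetric] divide_simps) (simp add: algebra_simps)
  moreover have "2 * (1 / 2) powr \<theta> = q"
    by (simp add: q_def powr_diff powr_divide)
  ultimately show ?thesis
    by (metis mult.left_commute)
qed

text \<open>Splitting at the partition interval that contains the midpoint halves the length of both
  remaining pieces, and \<open>\<theta> > 1\<close> makes the resulting geometric series converge.\<close>

lemma norm_partition_sum_diff_le:
  assumes "ps \<in> partitions s t" "0 \<le> s" "t \<le> T"
  shows "norm (partition_sum A ps - A s t) \<le> sew_const * (t - s) powr \<theta>"
  using assms
proof (induction "length ps" arbitrary: ps s t rule: less_induct)
  case less
  show ?case
  proof (cases "s = t")
    case True
    \<comment> \<open>The only partition of [s,s] has an empty sum, so A must vanish on the
      diagonal; the defect bound at u = m = v says so, because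
      \<open>0 powr \<theta> = 0\<close>.\<close>
    have "norm (A s s) = 0"
      using defect[of s s s] less.prems True by simp
    then show ?thesis
      using less.prems True partitions_trivial by fastforce
  next
    case False
    then have st: "s < t" using partitions_le[OF less.prems(1)] by simp
    define c where "c = (s + t) / 2"
    define xs where "xs = takeWhile (\<lambda>x. x \<le> c) ps"
    define ys where "ys = dropWhile (\<lambda>x. x \<le> c) ps"
    have ps: "ps = xs @ ys" by (simp add: xs_def ys_def)
    have ht: "hd ps = s" "last ps = t" "ps \<noteq> []" using less.prems(1) by (auto simp: partitions_def)
    have "xs \<noteq> []" using ht st by (cases ps) (auto simp: xs_def c_def)
    then obtain xs' u where xs: "xs = xs' @ [u]" by (cases xs rule: rev_cases) auto
    have "u \<in> set xs" by (simp add: xs)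
    then have uc: "u \<le> c" unfolding xs_def by (auto dest: set_takeWhileD)
    have "ys \<noteq> []"
    proof
      assume "ys = []"
      then have "\<forall>x\<in>set ps. x \<le> c" by (simp add: ys_def dropWhile_eq_Nil_conv)
      then show False using ht st last_in_set[of ps] by (auto simp: c_def)
    qed
    then obtain v ys' where ys: "ys = v # ys'" by (cases ys) auto
    have vc: "c < v" using ys unfolding ys_def by (metis dropWhile_eq_Cons_conv not_le)
    have p1: "xs \<in> partitions s u" and p2': "u # ys \<in> partitions u t"
      using less.prems(1) partitions_append[of xs' u ys s t] unfolding ps xs by auto
    have p2: "ys \<in> partitions v t"
      using p2' unfolding ys by (auto simp: partitions_def)
    have le: "s \<le> u" "u \<le> v" "v \<le> t"
      using partitions_le p1 p2 uc vc by fastforce+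
    have s1: "norm (partition_sum A xs - A s u) \<le> sew_const * (u - s) powr \<theta>"
      using less.hyps[OF _ p1] less.prems le by (simp add: ps ys)
    have s2: "norm (partition_sum A ys - A v t) \<le> sew_const * (t - v) powr \<theta>"
      using less.hyps[OF _ p2] less.prems le by (simp add: ps xs)
    have half: "sew_const * x powr \<theta> \<le> sew_const * (1 / 2) powr \<theta> * (t - s) powr \<theta>"
      if "0 \<le> x" "x \<le> (t - s) / 2" for x
    proof -
      have "x powr \<theta> \<le> ((1 / 2) * (t - s)) powr \<theta>"
        using that theta by (intro powr_mono2) auto
      also have "\<dots> = (1 / 2) powr \<theta> * (t - s) powr \<theta>"
        using st by (subst powr_mult) auto
      finally show ?thesis
        using sew_const_nonneg by (metis mult.assoc mult_left_mono)
    qed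
    have d1: "norm (A s t - A s u - A u t) \<le> K * (t - s) powr \<theta>"
      using defect[of s u t] le less.prems by simp
    have "norm (A u t - A u v - A v t) \<le> K * (t - u) powr \<theta>"
      using defect[of u v t] le less.prems by simp
    also have "\<dots> \<le> K * (t - s) powr \<theta>"
      using K_nonneg le theta by (intro mult_left_mono powr_mono2) auto
    finally have d2: "norm (A u t - A u v - A v t) \<le> K * (t - s) powr \<theta>" .
    \<comment> \<open>Replacing A s t by A s u + A u v + A v t costs two defects, the term
      \<open>2 * K\<close> of \<open>sew_const_eq\<close>.\<close>
    have "partition_sum A ps - A s t = (partition_sum A xs - A s u) + (partition_sum A ys - A v t)
        - (A s t - A s u - A u t) - (A u t - A u v - A v t)"
      unfolding ps xs ys using partition_sum_append[of A xs' u "v # ys'"] by (simp add: partition_sum_Cons)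
    then have "norm (partition_sum A ps - A s t) \<le> sew_const * (u - s) powr \<theta>
        + sew_const * (t - v) powr \<theta> + K * (t - s) powr \<theta> + K * (t - s) powr \<theta>"
      using s1 s2 d1 d2 by (smt (verit) norm_triangle_ineq norm_triangle_ineq4)
    also have "\<dots> \<le> 2 * (sew_const * (1 / 2) powr \<theta> * (t - s) powr \<theta>)
        + 2 * (K * (t - s) powr \<theta>)"
    proof -
      have "u - s \<le> (t - s) / 2" "t - v \<le> (t - s) / 2"
        using uc vc by (simp_all add: c_def field_simps)
      then show ?thesis
        using half[of "u - s"] half[of "t - v"] le by linarith
    qed
    also have "\<dots> = (2 * (sew_const * (1 / 2) powr \<theta>) + 2 * K) * (t - s) powr \<theta>"
      by (simp add: algebra_simps)
    finally show ?thesis unfolding sew_const_eq .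
  qed
qed

text \<open>On each interval of \<open>ps\<close> the finer \<open>qs\<close> restricts to a
  partition, to which the single-interval estimate applies. The induction peels off the first
  interval of \<open>ps\<close> and the part \<open>q1\<close> of \<open>qs\<close> inside
  it.\<close>

lemma norm_partition_sum_refine_le:
  assumes "ps \<in> partitions s t" "qs \<in> partitions s t" "set ps \<subseteq> set qs" "0 \<le> s" "t \<le> T"
  shows "norm (partition_sum A qs - partition_sum A ps)
    \<le> partition_sum (\<lambda>u v. sew_const * (v - u) powr \<theta>) ps"
  using assms
proof (induction ps arbitrary: s qs)
  case (Cons x ps)
  show ?case
  proof (cases ps)
    case Nil
    then have "s = t" "x = s" using Cons.prems by (auto simp: partitions_def)
    then have "qs = [s]" using partitions_trivial Cons.prems(2) by blast
    then show ?thesis by (simp add: Nil \<open>x = s\<close>)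
  next
    case (Cons r ps')
    from Cons.prems(3) Cons obtain q1 q2 where qs: "qs = q1 @ r # q2"
      by (metis insert_subset list.simps(15) split_list)
    have q: "q1 @ [r] \<in> partitions s r" "r # q2 \<in> partitions r t"
      using Cons.prems(2) partitions_append[of q1 r q2 s t] unfolding qs by auto
    have x: "x = s" "s < r" "r \<le> t" "r # ps' \<in> partitions r t"
      using partitions_Cons[of x r ps' s t] Cons.prems(1) Cons by auto
    \<comment> \<open>The points left in \<open>ps\<close> are at least r, those in
      \<open>q1\<close> are below r, so the inclusion survives the cut.\<close>
    have sub: "set ps \<subseteq> set (r # q2)"
    proof
      fix y assume y: "y \<in> set ps"
      then have "r \<le> y" using x(4) partitions_bounds(1) Cons by metis
      moreover have "y \<in> set qs" using y Cons.prems(3) by auto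
      moreover have "z < r" if "z \<in> set q1" for z
        using that q(1) by (auto simp: partitions_def sorted_wrt_append)
      ultimately show "y \<in> set (r # q2)" unfolding qs by force
    qed
    have "norm (partition_sum A (r # q2) - partition_sum A ps)
        \<le> partition_sum (\<lambda>u v. sew_const * (v - u) powr \<theta>) ps"
      using Cons.IH[OF _ q(2) sub] Cons x Cons.prems by auto
    moreover have "norm (partition_sum A (q1 @ [r]) - A s r) \<le> sew_const * (r - s) powr \<theta>"
      using norm_partition_sum_diff_le[OF q(1)] Cons.prems x by simp
    moreover have "partition_sum A qs - partition_sum A (x # ps) =
      (partition_sum A (r # q2) - partition_sum A ps) + (partition_sum A (q1 @ [r]) - A s r)"
      unfolding qs Cons x(1) using partition_sum_append[of A q1 r q2] by (simp add: partition_sum_Cons)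
    ultimately show ?thesis
      unfolding Cons x(1) partition_sum_Cons by (smt (verit) norm_triangle_ineq)
  qed
qed (auto simp: partitions_def)

text \<open>Neither partition need refine the other; both are compared with the sorted union
  \<open>rs\<close> of their points, whence the factor 2.\<close>

lemma norm_partition_sums_diff_le:
  assumes "ps \<in> partitions s t" "qs \<in> partitions s t" "mesh_below \<delta> ps" "mesh_below \<delta> qs"
    and "0 \<le> s" "t \<le> T"
  shows "norm (partition_sum A ps - partition_sum A qs)
    \<le> 2 * (sew_const * \<delta> powr (\<theta> - 1) * (t - s))"
proof -
  define rs where "rs = sorted_list_of_set (set ps \<union> set qs)"
  have rs: "rs \<in> partitions s t"
  proof -
    have set: "set rs = set ps \<union> set qs" by (simp add: rs_def)
    have bnd: "s \<le> x" "x \<le> t" if "x \<in> set rs" for x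
      using that partitions_bounds assms(1,2) unfolding set by blast+
    have mem: "s \<in> set rs" "t \<in> set rs"
      using assms(1) unfolding set by (auto simp: partitions_def)
    have sorted: "sorted_wrt (<) rs" unfolding rs_def by simp
    have "hd rs = s"
      using mem bnd sorted by (cases rs) fastforce+
    moreover have "last rs = t"
      using mem bnd sorted by (cases rs rule: rev_cases) (fastforce simp: sorted_wrt_append)+
    ultimately show ?thesis using mem sorted by (auto simp: partitions_def)
  qed
  have "norm (partition_sum A rs - partition_sum A ps) \<le> sew_const * \<delta> powr (\<theta> - 1) * (t - s)"
    using norm_partition_sum_refine_le[OF assms(1) rs]
      partition_sum_powr_le[OF assms(1,3) theta sew_const_nonneg] assms(5,6) by (auto simp: rs_def)
  moreover have "norm (partition_sum A rs - partition_sum A qs) \<le> sew_const * \<delta> powr (\<theta> - 1) * (t - s)"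
    using norm_partition_sum_refine_le[OF assms(2) rs]
      partition_sum_powr_le[OF assms(2,4) theta sew_const_nonneg] assms(5,6) by (auto simp: rs_def)
  ultimately have "norm ((partition_sum A rs - partition_sum A qs) - (partition_sum A rs - partition_sum A ps))
      \<le> 2 * (sew_const * \<delta> powr (\<theta> - 1) * (t - s))"
    by (intro norm_triangle_le_diff) simp
  then show ?thesis by simp
qed

theorem sewing:
  assumes "0 \<le> s" "s \<le> t" "t \<le> T"
  obtains I where "has_partition_limit A I s t" "norm (I - A s t) \<le> sew_const * (t - s) powr \<theta>"
proof -
  \<comment> \<open>A sequence of test partitions reduces convergence along the filter to
    completeness for sequences.\<close>
  have "\<exists>ps. ps \<in> partitions s t \<and> mesh_below (1 / real (Suc n)) ps" for n
    using partitions_fine[OF assms(2), of "1 / real (Suc n)"] by auto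
  then obtain P where P: "\<And>n. P n \<in> partitions s t" "\<And>n. mesh_below (1 / real (Suc n)) (P n)"
    by metis
  have cauchy: "\<exists>\<delta>>0. \<forall>ps\<in>partitions s t. \<forall>qs\<in>partitions s t. mesh_below \<delta> ps \<longrightarrow> mesh_below \<delta> qs
      \<longrightarrow> norm (partition_sum A ps - partition_sum A qs) < \<epsilon>" if eps: "0 < \<epsilon>" for \<epsilon>
  proof -
    obtain \<delta> where "0 < \<delta>" "(2 * (sew_const * (t - s))) * \<delta> powr (\<theta> - 1) < \<epsilon>"
      using ex_mult_powr_less[OF theta eps] by blast
    then show ?thesis
      by (intro exI[of _ \<delta>] conjI ballI impI order.strict_trans1[OF norm_partition_sums_diff_le])
        (use assms in \<open>auto simp: mult_ac\<close>)
  qed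
  have fine: "\<exists>N. \<forall>n\<ge>N. mesh_below \<delta> (P n)" if pos: "0 < \<delta>" for \<delta>
  proof -
    obtain N where N: "1 / real (Suc N) < \<delta>"
      using nat_approx_posE[OF pos] by blast
    have "mesh_below \<delta> (P n)" if "n \<ge> N" for n
    proof -
      have "1 / real (Suc n) \<le> 1 / real (Suc N)" using that by (simp add: frac_le)
      with N have "1 / real (Suc n) < \<delta>" by linarith
      then show ?thesis using P(2)[of n] unfolding mesh_below_def by (meson less_trans)
    qed
    then show ?thesis by blast
  qed
  have "Cauchy (\<lambda>n. partition_sum A (P n))"
    unfolding Cauchy_iff using cauchy fine P(1) by metis
  then obtain I where I: "(\<lambda>n. partition_sum A (P n)) \<longlonglongrightarrow> I"
    using Cauchy_convergent convergent_def by blast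
  have lim: "has_partition_limit A I s t"
    unfolding has_partition_limit_iff
  proof (intro allI impI)
    fix \<epsilon> :: real assume "0 < \<epsilon>"
    then obtain \<delta> where \<delta>: "0 < \<delta>" "\<And>ps qs. ps\<in>partitions s t \<Longrightarrow> qs\<in>partitions s t \<Longrightarrow>
        mesh_below \<delta> ps \<Longrightarrow> mesh_below \<delta> qs \<Longrightarrow>
        norm (partition_sum A ps - partition_sum A qs) < \<epsilon> / 2"
      using cauchy[of "\<epsilon> / 2"] by auto
    obtain N where N: "\<And>n. n \<ge> N \<Longrightarrow> mesh_below \<delta> (P n)" using fine \<delta>(1) by blast
    \<comment> \<open>Letting n tend to infinity in the Cauchy estimate turns < into \<le>, hence
      the margin \<epsilon>/2.\<close>
    have "norm (partition_sum A ps - I) \<le> \<epsilon> / 2"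
      if ps: "ps \<in> partitions s t" "mesh_below \<delta> ps" for ps
    proof (rule Lim_norm_ubound)
      show "(\<lambda>n. partition_sum A ps - partition_sum A (P n)) \<longlonglongrightarrow> partition_sum A ps - I"
        by (intro tendsto_intros I)
      show "\<forall>\<^sub>F n in sequentially. norm (partition_sum A ps - partition_sum A (P n)) \<le> \<epsilon> / 2"
        using eventually_ge_at_top[of N] by eventually_elim (use \<delta>(2) ps P(1) N in fastforce)
    qed simp
    with \<delta>(1) \<open>0 < \<epsilon>\<close> show "\<exists>\<delta>>0. \<forall>ps\<in>partitions s t. mesh_below \<delta> ps \<longrightarrow>
        norm (partition_sum A ps - I) < \<epsilon>"
      by (intro exI[of _ \<delta>]) fastforce
  qed
  \<comment> \<open>The single-interval estimate is uniform in the partition and so survives the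
    limit.\<close>
  have "norm (I - A s t) \<le> sew_const * (t - s) powr \<theta>"
  proof (rule Lim_norm_ubound)
    show "(\<lambda>n. partition_sum A (P n) - A s t) \<longlonglongrightarrow> I - A s t"
      by (intro tendsto_intros I)
    show "\<forall>\<^sub>F n in sequentially. norm (partition_sum A (P n) - A s t) \<le> sew_const * (t - s) powr \<theta>"
      using norm_partition_sum_diff_le P(1) assms by (intro always_eventually) auto
  qed simp
  with lim that show thesis by blast
qed

end

section \<open>Extension of bounded bilinear maps to the tensor product\<close>

text \<open>A purely algebraic extension from the independent set \<open>{x}\<close>. The functional
  may be unbounded, which is harmless: the universal property in \<open>projective_tensor\<close>
  covers unbounded bilinear forms.\<close>

lemma separating_linear_functional:
  fixes x :: "'a::real_vector"
  assumes "x \<noteq> 0"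
  obtains f :: "'a \<Rightarrow> real" where "linear f" "f x \<noteq> 0"
proof -
  have "independent {x}" using assms by simp
  from linear_independent_extend[OF this, of "\<lambda>_. 1 :: real"] that show thesis
    by auto
qed

text \<open>Meant for a total f that is meaningful only on the dense subspace S. On S it is
  Lipschitz, hence extends continuously, and the algebraic laws and the bound pass to
  limits.\<close>

lemma bounded_linear_extension:
  fixes f :: "'a::real_normed_vector \<Rightarrow> 'b::banach"
  assumes S: "subspace S" "closure S = UNIV"
    and add: "\<And>x y. x \<in> S \<Longrightarrow> y \<in> S \<Longrightarrow> f (x + y) = f x + f y"
    and scale: "\<And>c x. x \<in> S \<Longrightarrow> f (c *\<^sub>R x) = c *\<^sub>R f x"
    and bound: "\<And>x. x \<in> S \<Longrightarrow> norm (f x) \<le> K * norm x"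
  obtains L :: "'a \<Rightarrow>\<^sub>L 'b" where "\<And>x. x \<in> S \<Longrightarrow> blinfun_apply L x = f x"
    "\<And>x. norm (blinfun_apply L x) \<le> K * norm x"
proof -
  have diff: "f x - f y = f (x - y)" if "x \<in> S" "y \<in> S" for x y
    using add[of "x - y" y] that S(1) by (simp add: subspace_diff)
  \<comment> \<open>A Lipschitz constant must be nonnegative, and K has no assumed sign.\<close>
  have "(max K 0)-lipschitz_on S f"
  proof (rule lipschitz_onI)
    fix x y assume "x \<in> S" "y \<in> S"
    then have "dist (f x) (f y) \<le> K * dist x y"
      using bound[of "x - y"] S(1) by (simp add: dist_norm diff subspace_diff)
    also have "\<dots> \<le> max K 0 * dist x y" by (intro mult_right_mono) auto
    finally show "dist (f x) (f y) \<le> max K 0 * dist x y" .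
  qed simp
  then have "uniformly_continuous_on S f" by (rule lipschitz_on_uniformly_continuous)
  then obtain g where g: "uniformly_continuous_on (closure S) g" "\<And>x. x \<in> S \<Longrightarrow> f x = g x"
    using uniformly_continuous_on_extension_on_closure by metis
  have cont: "continuous_on UNIV g"
    using uniformly_continuous_imp_continuous[OF g(1)] S(2) by simp
  have approx: "\<exists>xs. (\<forall>n. xs n \<in> S) \<and> xs \<longlonglongrightarrow> x" for x
    using S(2) closure_sequential[of x S] by auto
  have lim: "(\<lambda>n. f (xs n)) \<longlonglongrightarrow> g x" if "\<forall>n. xs n \<in> S" "xs \<longlonglongrightarrow> x" for xs x
  proof -
    have "(\<lambda>n. g (xs n)) \<longlonglongrightarrow> g x"
      by (rule continuous_on_tendsto_compose[OF cont that(2)]) auto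
    then show ?thesis using g(2) that(1) by simp
  qed
  have g_add: "g (x + y) = g x + g y" for x y
  proof -
    obtain xs ys where xs: "\<forall>n. xs n \<in> S" "xs \<longlonglongrightarrow> x" and ys: "\<forall>n. ys n \<in> S" "ys \<longlonglongrightarrow> y"
      using approx by meson
    have "(\<lambda>n. f (xs n + ys n)) \<longlonglongrightarrow> g (x + y)"
      using xs ys S(1) by (intro lim) (auto intro: tendsto_add subspace_add)
    moreover have "(\<lambda>n. f (xs n + ys n)) \<longlonglongrightarrow> g x + g y"
      using tendsto_add[OF lim[OF xs] lim[OF ys]] add xs ys by simp
    ultimately show ?thesis by (rule LIMSEQ_unique)
  qed
  have g_scale: "g (c *\<^sub>R x) = c *\<^sub>R g x" for c x
  proof -
    obtain xs where xs: "\<forall>n. xs n \<in> S" "xs \<longlonglongrightarrow> x"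
      using approx by meson
    have "(\<lambda>n. f (c *\<^sub>R xs n)) \<longlonglongrightarrow> g (c *\<^sub>R x)"
      using xs S(1) by (intro lim) (auto intro: tendsto_scaleR subspace_scale)
    moreover have "(\<lambda>n. f (c *\<^sub>R xs n)) \<longlonglongrightarrow> c *\<^sub>R g x"
      using tendsto_scaleR[OF tendsto_const lim[OF xs], of c] scale xs by simp
    ultimately show ?thesis by (rule LIMSEQ_unique)
  qed
  have g_bound: "norm (g x) \<le> K * norm x" for x
  proof -
    obtain xs where xs: "\<forall>n. xs n \<in> S" "xs \<longlonglongrightarrow> x"
      using approx by meson
    have "(\<lambda>n. norm (f (xs n))) \<longlonglongrightarrow> norm (g x)" "(\<lambda>n. K * norm (xs n)) \<longlonglongrightarrow> K * norm x"
      using xs lim[OF xs] by (auto intro!: tendsto_intros)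
    then show ?thesis
      by (rule LIMSEQ_le) (use bound xs in auto)
  qed
  have "bounded_linear g"
    by (rule bounded_linear_intro[of g K]) (use g_add g_scale g_bound in \<open>auto simp: mult.commute\<close>)
  then have "blinfun_apply (Blinfun g) = g" by (rule bounded_linear_Blinfun_apply)
  then show thesis using that[of "Blinfun g"] g(2) g_bound by simp
qed

text \<open>Keeps the constant that \<open>bounded_bilinear\<close> hides: it enters the universal
  bound.\<close>

definition bounded_bilinear_by :: "('a::real_normed_vector \<Rightarrow> 'b::real_normed_vector \<Rightarrow>
    'e::real_normed_vector) \<Rightarrow> real \<Rightarrow> bool" where
  "bounded_bilinear_by B K \<longleftrightarrow> bilinear B \<and> 0 \<le> K \<and> (\<forall>x y. norm (B x y) \<le> K * (norm x * norm y))"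

locale projective_tensor_product =
  fixes tens :: "'a::banach \<Rightarrow> 'b::banach \<Rightarrow> 'c::banach"
  assumes projective: "projective_tensor tens"
begin

lemma bilinear_tens: "bilinear tens"
  using projective by (simp add: projective_tensor_def)

definition tens_sum :: "('a \<times> 'b) list \<Rightarrow> 'c" where
  "tens_sum xys = (\<Sum>(x, y)\<leftarrow>xys. tens x y)"

lemma tens_sum_Nil [simp]: "tens_sum [] = 0"
  and tens_sum_Cons [simp]: "tens_sum ((x, y) # xys) = tens x y + tens_sum xys"
  and tens_sum_append [simp]: "tens_sum (xys @ zs) = tens_sum xys + tens_sum zs"
  by (simp_all add: tens_sum_def)

definition "tens_span = span {tens x y | x y. True}"

lemma subspace_tens_span: "subspace tens_span"
  unfolding tens_span_def by (rule subspace_span)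

lemma closure_tens_span: "closure tens_span = UNIV"
  using projective by (simp add: projective_tensor_def tens_span_def)

lemma tens_in_span: "tens x y \<in> tens_span"
  unfolding tens_span_def by (rule span_base) blast

lemma tens_sum_in_span: "tens_sum xys \<in> tens_span"
proof (induction xys)
  case (Cons z xys)
  then show ?case by (cases z) (simp add: subspace_add[OF subspace_tens_span] tens_in_span)
qed (simp add: subspace_0[OF subspace_tens_span])

text \<open>Scalars can be absorbed into the left factor, so sums of elementary tensors without
  coefficients already exhaust the span.\<close>

lemma tens_span_eq_range: "tens_span = range tens_sum"
proof
  show "range tens_sum \<subseteq> tens_span" using tens_sum_in_span by auto
  show "tens_span \<subseteq> range tens_sum"
  proof
    fix p assume "p \<in> tens_span"
    then show "p \<in> range tens_sum"
      unfolding tens_span_def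
    proof (induction rule: span_induct_alt)
      case base
      show ?case by (rule range_eqI[of _ _ "[]"]) simp
    next
      case (step c q p)
      then obtain x y xys where "q = tens x y" "p = tens_sum xys" by auto
      then have "c *\<^sub>R q + p = tens_sum ((c *\<^sub>R x, y) # xys)"
        by (simp add: bilinear_lmul[OF bilinear_tens])
      then show ?case by blast
    qed
  qed
qed

lemma norm_tens_sum:
  "norm (tens_sum xys) = Inf {(\<Sum>(x, y)\<leftarrow>zs. norm x * norm y) | zs. tens_sum zs = tens_sum xys}"
  using projective tens_sum_in_span[of xys] unfolding projective_tensor_def tens_sum_def tens_span_def by simp

lemma norm_tens_sum_le: "norm (tens_sum xys) \<le> (\<Sum>(x, y)\<leftarrow>xys. norm x * norm y)"
  unfolding norm_tens_sum
proof (rule cInf_lower)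
  show "bdd_below {\<Sum>(x, y)\<leftarrow>zs. norm x * norm y |zs. tens_sum zs = tens_sum xys}"
    by (rule bdd_belowI[of _ 0]) (auto intro!: sum_list_nonneg)
qed auto

lemma norm_tens_le: "norm (tens x y) \<le> norm x * norm y"
  using norm_tens_sum_le[of "[(x, y)]"] by simp

lemma bounded_bilinear_tens: "bounded_bilinear tens"
  using bilinear_tens norm_tens_le
  by (intro bounded_bilinear.intro exI[of _ 1])
    (auto simp: bilinear_ladd bilinear_radd bilinear_lmul bilinear_rmul)

sublocale tens: bounded_bilinear tens
  by (rule bounded_bilinear_tens)

text \<open>Density of the span gives the uniqueness behind the \<open>THE\<close> in
  \<open>tensor_ext\<close>.\<close>

lemma blinfun_eq_if_eq_on_tens:
  fixes L M :: "'c \<Rightarrow>\<^sub>L 'e::real_normed_vector"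
  assumes "\<And>x y. blinfun_apply L (tens x y) = blinfun_apply M (tens x y)"
  shows "L = M"
proof (rule blinfun_eqI)
  fix p :: 'c
  have span: "blinfun_apply L q = blinfun_apply M q" if "q \<in> tens_span" for q
    using that unfolding tens_span_def by (induction rule: span_induct_alt) (auto simp: blinfun.bilinear_simps assms)
  have "closed {q. blinfun_apply L q = blinfun_apply M q}"
    by (intro closed_Collect_eq continuous_intros)
  then have "closure tens_span \<subseteq> {q. blinfun_apply L q = blinfun_apply M q}"
    using span by (intro closure_minimal) auto
  then show "blinfun_apply L p = blinfun_apply M p"
    using closure_tens_span by auto
qed

text \<open>The universal property only provides real-valued functionals on the tensor product; composing
  \<open>B\<close> with the functionals that separate the points of \<open>'e\<close> gives well-definedness for all \<open>B\<close>.\<close>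

lemma bilinear_sum_eq_0:
  fixes B :: "'a \<Rightarrow> 'b \<Rightarrow> 'e::real_vector"
  assumes "bilinear B" "tens_sum xys = 0"
  shows "(\<Sum>(x, y)\<leftarrow>xys. B x y) = 0"
proof (rule ccontr)
  assume "(\<Sum>(x, y)\<leftarrow>xys. B x y) \<noteq> 0"
  then obtain \<phi> :: "'e \<Rightarrow> real" where \<phi>: "linear \<phi>" "\<phi> (\<Sum>(x, y)\<leftarrow>xys. B x y) \<noteq> 0"
    using separating_linear_functional by blast
  have "bilinear (\<lambda>x y. \<phi> (B x y))"
    using assms(1) \<phi>(1) unfolding bilinear_def by (auto intro: linear_compose[unfolded o_def])
  then obtain L where L: "linear L" "\<And>x y. L (tens x y) = \<phi> (B x y)"
    using projective unfolding projective_tensor_def by blast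
  have "L (tens_sum zs) = \<phi> (\<Sum>(x, y)\<leftarrow>zs. B x y)" for zs
    by (induction zs) (auto simp: linear_0 linear_add L \<phi>(1))
  then show False
    using \<phi>(2) assms(2) L(1) by (metis linear_0)
qed

text \<open>Appending one representation with negated left factors to the other gives a
  representation of 0.\<close>

lemma bilinear_sum_cong:
  fixes B :: "'a \<Rightarrow> 'b \<Rightarrow> 'e::real_vector"
  assumes "bilinear B" "tens_sum xys = tens_sum zs"
  shows "(\<Sum>(x, y)\<leftarrow>xys. B x y) = (\<Sum>(x, y)\<leftarrow>zs. B x y)"
proof -
  have neg: "tens_sum (map (\<lambda>(x, y). (- x, y)) zs) = - tens_sum zs"
    "(\<Sum>(x, y)\<leftarrow>map (\<lambda>(x, y). (- x, y)) zs. B x y) = - (\<Sum>(x, y)\<leftarrow>zs. B x y)"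
    by (induction zs) (auto simp: bilinear_lneg[OF bilinear_tens] bilinear_lneg[OF assms(1)])
  show ?thesis
    using bilinear_sum_eq_0[OF assms(1), of "xys @ map (\<lambda>(x, y). (- x, y)) zs"] assms(2) neg by simp
qed

text \<open>The constant K survives because every representation of p bounds the image of p, and the
  projective norm is the infimum of these bounds.\<close>

lemma tensor_ext_exists:
  fixes B :: "'a \<Rightarrow> 'b \<Rightarrow> 'e::banach"
  assumes B: "bounded_bilinear_by B K"
  obtains L :: "'c \<Rightarrow>\<^sub>L 'e" where "\<And>x y. blinfun_apply L (tens x y) = B x y"
    "\<And>p. norm (blinfun_apply L p) \<le> K * norm p"
proof -
  have bil: "bilinear B" and bd: "norm (B x y) \<le> K * (norm x * norm y)" for x y
    using B by (auto simp: bounded_bilinear_by_def)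
  \<comment> \<open>The representation is an arbitrary choice; \<open>bilinear_sum_cong\<close>
    makes the value independent of it.\<close>
  define f where "f p = (\<Sum>(x, y)\<leftarrow>(SOME xys. tens_sum xys = p). B x y)" for p
  have f: "f (tens_sum xys) = (\<Sum>(x, y)\<leftarrow>xys. B x y)" for xys
    unfolding f_def by (rule bilinear_sum_cong[OF bil]) (rule someI[of _ xys], simp)
  have scaled: "tens_sum (map (\<lambda>(x, y). (c *\<^sub>R x, y)) zs) = c *\<^sub>R tens_sum zs"
    "(\<Sum>(x, y)\<leftarrow>map (\<lambda>(x, y). (c *\<^sub>R x, y)) zs. B x y) = c *\<^sub>R (\<Sum>(x, y)\<leftarrow>zs. B x y)" for c zs
    by (induction zs)
      (auto simp: bilinear_lmul[OF bilinear_tens] bilinear_lmul[OF bil] scaleR_add_right)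
  have fbound: "norm (f (tens_sum xys)) \<le> K * norm (tens_sum xys)" for xys
  \<comment> \<open>The infimum is compared after division by K; K = 0 forces B = 0 and is treated
    apart.\<close>
  proof (cases "0 < K")
    case True
    have "norm (f (tens_sum xys)) / K \<le> norm (tens_sum xys)"
      unfolding norm_tens_sum[of xys]
    proof (rule cInf_greatest)
      fix r assume "r \<in> {\<Sum>(x, y)\<leftarrow>zs. norm x * norm y |zs. tens_sum zs = tens_sum xys}"
      then obtain zs where zs: "r = (\<Sum>(x, y)\<leftarrow>zs. norm x * norm y)" "tens_sum zs = tens_sum xys"
        by auto
      have "norm (\<Sum>(x, y)\<leftarrow>zs. B x y) \<le> K * (\<Sum>(x, y)\<leftarrow>zs. norm x * norm y)"
      proof (induction zs)
        case (Cons z zs)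
        then show ?case
          by (cases z) (auto simp: distrib_left intro!: norm_triangle_mono bd)
      qed simp
      then show "norm (f (tens_sum xys)) / K \<le> r"
        using True f[of zs] zs by (simp add: divide_le_eq mult.commute)
    qed auto
    then show ?thesis using True by (simp add: divide_le_eq mult.commute)
  next
    case False
    with B have "K = 0" by (simp add: bounded_bilinear_by_def)
    with bd have "B x y = 0" for x y by simp
    then have "(\<Sum>(x, y)\<leftarrow>xys. B x y) = 0" by (induction xys) auto
    with \<open>K = 0\<close> show ?thesis by (simp add: f)
  qed
  have "f (p + q) = f p + f q" if pq: "p \<in> tens_span" "q \<in> tens_span" for p q
  proof -
    obtain xs ys where "p = tens_sum xs" "q = tens_sum ys"
      using pq unfolding tens_span_eq_range by auto
    then show ?thesis using f[of "xs @ ys"] f by simp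
  qed
  moreover have "f (c *\<^sub>R p) = c *\<^sub>R f p" if p: "p \<in> tens_span" for c p
  proof -
    obtain xs where "p = tens_sum xs"
      using p unfolding tens_span_eq_range by auto
    then show ?thesis using f[of "map (\<lambda>(x, y). (c *\<^sub>R x, y)) xs"] f[of xs] scaled[of c xs] by metis
  qed
  moreover have "norm (f p) \<le> K * norm p" if "p \<in> tens_span" for p
    using that fbound unfolding tens_span_eq_range by auto
  ultimately obtain L :: "'c \<Rightarrow>\<^sub>L 'e" where L: "\<And>p. p \<in> tens_span \<Longrightarrow> blinfun_apply L p = f p"
    "\<And>p. norm (blinfun_apply L p) \<le> K * norm p"
    using bounded_linear_extension[OF subspace_tens_span closure_tens_span, of f K] by blast
  have "blinfun_apply L (tens x y) = B x y" for x y
    using L(1)[of "tens x y"] f[of "[(x, y)]"] by (simp add: tens_in_span)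
  with L(2) that show thesis by blast
qed

lemma tensor_ext_eqI:
  fixes L :: "'c \<Rightarrow>\<^sub>L 'e::banach"
  assumes "\<And>x y. blinfun_apply L (tens x y) = B x y"
  shows "tensor_ext tens B = L"
  unfolding tensor_ext_def using assms by (intro the_equality blinfun_eq_if_eq_on_tens) auto

lemma tensor_ext:
  fixes B :: "'a \<Rightarrow> 'b \<Rightarrow> 'e::banach"
  assumes "bounded_bilinear_by B K"
  shows tensor_ext_tens: "blinfun_apply (tensor_ext tens B) (tens x y) = B x y"
    and norm_tensor_ext_le: "norm (blinfun_apply (tensor_ext tens B) p) \<le> K * norm p"
  using tensor_ext_exists[OF assms] tensor_ext_eqI by metis+

lemma tensor_ext_diff:
  fixes B C :: "'a \<Rightarrow> 'b \<Rightarrow> 'e::banach"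
  assumes "bounded_bilinear_by B K" "bounded_bilinear_by C K'"
  shows "tensor_ext tens (\<lambda>x y. B x y - C x y) = tensor_ext tens B - tensor_ext tens C"
  using assms by (intro tensor_ext_eqI) (simp add: blinfun.diff_left tensor_ext_tens)

end

section \<open>Bounded bilinear maps and Hoelder bounds\<close>

lemma bounded_bilinear_by_add:
  assumes "bounded_bilinear_by B K" "bounded_bilinear_by C L"
  shows "bounded_bilinear_by (\<lambda>x y. B x y + C x y) (K + L)"
  using assms unfolding bounded_bilinear_by_def
  by (auto simp: bilinear_def linear_iff algebra_simps intro!: norm_triangle_mono)

lemma bounded_bilinear_by_blinfun:
  fixes L :: "'a::real_normed_vector \<Rightarrow>\<^sub>L 'b::real_normed_vector \<Rightarrow>\<^sub>L 'e::real_normed_vector"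
  shows "bounded_bilinear_by (\<lambda>x y. blinfun_apply (blinfun_apply L x) y) (norm L)"
proof -
  have "norm (blinfun_apply (blinfun_apply L x) y) \<le> norm L * (norm x * norm y)" for x y
    by (rule order_trans[OF norm_blinfun])
      (auto simp: mult.assoc[symmetric] intro!: mult_right_mono norm_blinfun)
  then show ?thesis
    by (auto simp: bounded_bilinear_by_def bilinear_def linear_iff blinfun.bilinear_simps)
qed

lemma (in projective_tensor_product) bounded_bilinear_by_tens_comp:
  fixes P :: "'d::real_normed_vector \<Rightarrow>\<^sub>L 'a" and Q :: "'f::real_normed_vector \<Rightarrow>\<^sub>L 'b"
  assumes "norm P \<le> p" "norm Q \<le> q"
  shows "bounded_bilinear_by (\<lambda>x y. tens (blinfun_apply P x) (blinfun_apply Q y)) (p * q)"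
proof -
  have pq: "0 \<le> p" "0 \<le> q" using assms norm_ge_zero order_trans by blast+
  have "norm (tens (blinfun_apply P x) (blinfun_apply Q y)) \<le> p * q * (norm x * norm y)" for x y
  proof -
    have "norm (blinfun_apply P x) \<le> p * norm x" "norm (blinfun_apply Q y) \<le> q * norm y"
      using assms by (meson mult_right_mono norm_blinfun norm_ge_zero order_trans)+
    then have "norm (blinfun_apply P x) * norm (blinfun_apply Q y) \<le> (p * norm x) * (q * norm y)"
      using pq by (intro mult_mono) auto
    then show ?thesis
      using order_trans[OF norm_tens_le] by (simp add: mult_ac)
  qed
  then show ?thesis
    using pq by (auto simp: bounded_bilinear_by_def bilinear_def linear_iff blinfun.bilinear_simps
        tens.add_left tens.add_right tens.scaleR_left tens.scaleR_right)
qed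

text \<open>Both operators agree on elementary tensors. This is what turns the second-level term of
  the controlled equation into one over W.\<close>

lemma tensor_ext_comp:
  fixes B :: "'w::banach \<Rightarrow> 'w \<Rightarrow> 'e::banach" and P :: "'v::banach \<Rightarrow>\<^sub>L 'w"
  assumes "projective_tensor_product tensV" "projective_tensor_product tensW"
    and B: "bounded_bilinear_by B K"
  shows "tensor_ext tensV (\<lambda>x y. B (blinfun_apply P x) (blinfun_apply P y)) =
    tensor_ext tensW B o\<^sub>L
      tensor_ext tensV (\<lambda>x y. tensW (blinfun_apply P x) (blinfun_apply P y))"
proof -
  interpret V: projective_tensor_product tensV by fact
  interpret W: projective_tensor_product tensW by fact
  note V.tensor_ext_tens[OF W.bounded_bilinear_by_tens_comp[OF order_refl order_refl, of P P]]
  then show ?thesis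
    by (intro V.tensor_ext_eqI) (simp add: W.tensor_ext_tens[OF B])
qed

section \<open>Hoelder seminorms as suprema of quotients\<close>

lemma holder_quotient_le:
  assumes "holder_finite T \<gamma> A" "0 \<le> s" "s < t" "t \<le> T"
  shows "norm (A s t) / (t - s) powr \<gamma> \<le> holder_norm T \<gamma> A"
  unfolding holder_norm_def
proof (rule cSup_upper)
  show "norm (A s t) / (t - s) powr \<gamma> \<in> holder_quotients T \<gamma> A"
    unfolding holder_quotients_def using assms by blast
qed (use assms(1) in \<open>simp add: holder_finite_def\<close>)

text \<open>The quotients ignore the diagonal, where the right-hand side is 0; hence the hypothesis
  on \<open>A s s\<close>.\<close>

lemma holder_normD:
  assumes "holder_finite T \<gamma> A" "0 \<le> s" "s \<le> t" "t \<le> T" "A s s = 0"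
  shows "norm (A s t) \<le> holder_norm T \<gamma> A * (t - s) powr \<gamma>"
  using assms holder_quotient_le[of T \<gamma> A s t] by (cases "s = t") (auto simp: divide_le_eq)

lemma holder_norm_nonneg:
  assumes "0 < T" "holder_finite T \<gamma> A"
  shows "0 \<le> holder_norm T \<gamma> A"
  using order_trans[OF divide_nonneg_nonneg[OF norm_ge_zero powr_ge_zero]
      holder_quotient_le[OF assms(2) order_refl assms(1) order_refl]] .

lemma holderI:
  assumes "\<And>s t. 0 \<le> s \<Longrightarrow> s \<le> t \<Longrightarrow> t \<le> T \<Longrightarrow> norm (A s t) \<le> K * (t - s) powr \<gamma>"
  shows holder_finiteI: "holder_finite T \<gamma> A"
    and holder_norm_leI: "0 < T \<Longrightarrow> holder_norm T \<gamma> A \<le> K"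
proof -
  have le: "x \<le> K" if "x \<in> holder_quotients T \<gamma> A" for x
    using that assms by (auto simp: holder_quotients_def divide_le_eq)
  show "holder_finite T \<gamma> A"
    unfolding holder_finite_def by (rule bdd_aboveI[OF le])
  \<comment> \<open>Now the set of quotients is nonempty, so that its \<open>Sup\<close> is bounded
    by any upper bound.\<close>
  assume "0 < T"
  then have "norm (A 0 T) / (T - 0) powr \<gamma> \<in> holder_quotients T \<gamma> A"
    unfolding holder_quotients_def by blast
  then show "holder_norm T \<gamma> A \<le> K"
    unfolding holder_norm_def by (intro cSup_least le) auto
qed

section \<open>The lift of a controlled rough path\<close>

definition deriv_bound :: "real \<Rightarrow> real \<Rightarrow> real \<Rightarrow> real \<Rightarrow> real" where
  "deriv_bound \<alpha> T b c = b + c * T powr \<alpha>"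

text \<open>Here \<open>a\<close>, \<open>b\<close>, \<open>c\<close> stand for the size of X, of Z'
  at 0 and of the controlled seminorm. \<open>deriv_bound\<close> dominates Z' on [0,T]; this
  constant dominates the \<alpha>-Hoelder seminorm of Z.\<close>

definition path_bound :: "real \<Rightarrow> real \<Rightarrow> real \<Rightarrow> real \<Rightarrow> real \<Rightarrow> real" where
  "path_bound \<alpha> T a b c = deriv_bound \<alpha> T b c * a + c * T powr \<alpha>"

text \<open>The summands match, in order, the three terms of the defect in
  \<open>germ_defect\<close>.\<close>

definition defect_bound :: "real \<Rightarrow> real \<Rightarrow> real \<Rightarrow> real \<Rightarrow> real \<Rightarrow> real" where
  "defect_bound \<alpha> T a b c = c * path_bound \<alpha> T a b c +
     deriv_bound \<alpha> T b c * a * (c + c * a) + 2 * deriv_bound \<alpha> T b c * c * a"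

text \<open>This is \<open>sew_const\<close> for \<theta> = 3 \<alpha>.\<close>

definition sewing_bound :: "real \<Rightarrow> real \<Rightarrow> real \<Rightarrow> real \<Rightarrow> real \<Rightarrow> real" where
  "sewing_bound \<alpha> T a b c = 2 / (1 - 2 powr (1 - 3 * \<alpha>)) * defect_bound \<alpha> T a b c"

text \<open>The first summand is for Z, the bracket for its second level, where one factor
  \<open>(t - s) powr \<alpha>\<close> of the sewing error is traded for
  \<open>T powr \<alpha>\<close>.\<close>

definition lift_bound :: "real \<Rightarrow> real \<Rightarrow> real \<Rightarrow> real \<Rightarrow> real \<Rightarrow> real" where
  "lift_bound \<alpha> T a b c = path_bound \<alpha> T a b c +
     (deriv_bound \<alpha> T b c * deriv_bound \<alpha> T b c * a + sewing_bound \<alpha> T a b c * T powr \<alpha>)"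

lemma bounds_nonneg:
  assumes "0 \<le> a" "0 \<le> b" "0 \<le> c"
  shows "0 \<le> deriv_bound \<alpha> T b c" "0 \<le> path_bound \<alpha> T a b c" "0 \<le> defect_bound \<alpha> T a b c"
  using assms by (simp_all add: deriv_bound_def path_bound_def defect_bound_def)

lemma lift_bound_mono:
  assumes "1 / 3 < \<alpha>" "0 \<le> T" "T \<le> T'" "0 \<le> a" "a \<le> a'" "0 \<le> b" "b \<le> b'" "0 \<le> c" "c \<le> c'"
  shows "lift_bound \<alpha> T a b c \<le> lift_bound \<alpha> T' a' b' c'"
proof -
  have T: "T powr \<alpha> \<le> T' powr \<alpha>" using assms by (intro powr_mono2) auto
  have nn: "0 \<le> a'" "0 \<le> b'" "0 \<le> c'" using assms by auto
  note nonneg = bounds_nonneg[OF assms(4,6,8)] bounds_nonneg[OF nn]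
  have d: "deriv_bound \<alpha> T b c \<le> deriv_bound \<alpha> T' b' c'"
    unfolding deriv_bound_def using assms T by (intro add_mono mult_mono) auto
  have p: "path_bound \<alpha> T a b c \<le> path_bound \<alpha> T' a' b' c'"
    unfolding path_bound_def using assms T d nonneg by (intro add_mono mult_mono) auto
  have "defect_bound \<alpha> T a b c \<le> defect_bound \<alpha> T' a' b' c'"
    unfolding defect_bound_def using assms d p nonneg
    by (intro add_mono mult_mono mult_nonneg_nonneg) auto
  \<comment> \<open>Makes the denominator in \<open>sewing_bound\<close> positive.\<close>
  moreover have "2 powr (1 - 3 * \<alpha>) < (2::real) powr 0"
    using assms by (intro powr_less_mono) auto
  ultimately have s: "sewing_bound \<alpha> T a b c \<le> sewing_bound \<alpha> T' a' b' c'"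
    and s0: "0 \<le> sewing_bound \<alpha> T a b c"
    unfolding sewing_bound_def using nonneg
    by (auto intro!: mult_left_mono mult_nonneg_nonneg divide_nonneg_nonneg divide_right_mono)
  show ?thesis
    unfolding lift_bound_def using assms T d p s s0 nonneg
    by (intro add_mono mult_mono mult_nonneg_nonneg) auto
qed

text \<open>The data enter through majorants \<open>a\<close>, \<open>b\<close>, \<open>c\<close>
  instead of their norms, so every estimate is explicit in the future arguments of M. One
  \<open>a\<close> serves both levels of X, one \<open>c\<close> both parts of the controlled
  seminorm.\<close>

locale controlled_rough_path =
  V: projective_tensor_product tensV + W: projective_tensor_product tensW
  for tensV :: "'v::banach \<Rightarrow> 'v \<Rightarrow> 'vv::banach" and tensW :: "'w::banach \<Rightarrow> 'w \<Rightarrow> 'ww::banach" +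
  fixes \<alpha> T a b c :: real and X :: "real \<Rightarrow> real \<Rightarrow> 'v" and XX :: "real \<Rightarrow> real \<Rightarrow> 'vv"
    and Z :: "real \<Rightarrow> 'w" and Z' :: "real \<Rightarrow> 'v \<Rightarrow>\<^sub>L 'w"
  assumes alpha: "1 / 3 < \<alpha>" and T_pos: "0 < T"
    and nonneg: "0 \<le> a" "0 \<le> b" "0 \<le> c"
    and chen: "\<And>s u t. 0 \<le> s \<Longrightarrow> s \<le> u \<Longrightarrow> u \<le> t \<Longrightarrow> t \<le> T \<Longrightarrow>
      XX s t = XX s u + XX u t + tensV (X s u) (X u t)"
    and X_bound: "\<And>s t. 0 \<le> s \<Longrightarrow> s \<le> t \<Longrightarrow> t \<le> T \<Longrightarrow> norm (X s t) \<le> a * (t - s) powr \<alpha>"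
    and XX_bound: "\<And>s t. 0 \<le> s \<Longrightarrow> s \<le> t \<Longrightarrow> t \<le> T \<Longrightarrow> norm (XX s t) \<le> a * (t - s) powr (2 * \<alpha>)"
    and X_additive: "\<And>s u t. 0 \<le> s \<Longrightarrow> s \<le> u \<Longrightarrow> u \<le> t \<Longrightarrow> t \<le> T \<Longrightarrow> X s t = X s u + X u t"
    and Z'_0_bound: "norm (Z' 0) \<le> b"
    and remainder_bound: "\<And>s t. 0 \<le> s \<Longrightarrow> s \<le> t \<Longrightarrow> t \<le> T \<Longrightarrow>
      norm (Z t - Z s - Z' s (X s t)) \<le> c * (t - s) powr (2 * \<alpha>)"
    and Z'_bound: "\<And>s t. 0 \<le> s \<Longrightarrow> s \<le> t \<Longrightarrow> t \<le> T \<Longrightarrow> norm (Z' t - Z' s) \<le> c * (t - s) powr \<alpha>"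
begin

abbreviation "N \<equiv> deriv_bound \<alpha> T b c"
abbreviation "N\<^sub>Z \<equiv> path_bound \<alpha> T a b c"
abbreviation "germ \<equiv> lift_germ tensV tensW XX Z Z'"
abbreviation "ZZ \<equiv> lift2 tensV tensW XX Z Z'"

definition "square u = tensor_ext tensV (\<lambda>x y. tensW (Z' u x) (Z' u y))"

lemma germ_eq: "germ s u v = tensW (Z u - Z s) (Z v - Z u) + square u (XX u v)"
  by (simp add: lift_germ_def increments_def square_def)

lemma powr_sum: "h powr (2 * \<alpha>) = h powr \<alpha> * h powr \<alpha>"
  "h powr (3 * \<alpha>) = h powr \<alpha> * h powr \<alpha> * h powr \<alpha>" for h :: real
proof -
  have "2 * \<alpha> = \<alpha> + \<alpha>" "3 * \<alpha> = \<alpha> + \<alpha> + \<alpha>" by simp_all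
  then show "h powr (2 * \<alpha>) = h powr \<alpha> * h powr \<alpha>"
    "h powr (3 * \<alpha>) = h powr \<alpha> * h powr \<alpha> * h powr \<alpha>"
    by (simp_all only: powr_add)
qed

lemma powr_le: "0 \<le> h \<Longrightarrow> h \<le> k \<Longrightarrow> h powr \<alpha> \<le> k powr \<alpha>" for h k :: real
  using alpha by (intro powr_mono2) auto

text \<open>The free length h \<ge> t - s allows all factors of a defect to be measured by the same
  v - u although they live on subintervals.\<close>

lemma
  assumes "0 \<le> s" "s \<le> t" "t \<le> T" "t - s \<le> h"
  shows X_le: "norm (X s t) \<le> a * h powr \<alpha>"
    and XX_le: "norm (XX s t) \<le> a * (h powr \<alpha> * h powr \<alpha>)"
    and remainder_le: "norm (Z t - Z s - Z' s (X s t)) \<le> c * (h powr \<alpha> * h powr \<alpha>)"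
    and Z'_diff_le: "norm (Z' t - Z' s) \<le> c * h powr \<alpha>"
  using assms nonneg powr_le[of "t - s" h]
  by (auto intro!: order_trans[OF X_bound] order_trans[OF XX_bound] order_trans[OF remainder_bound]
      order_trans[OF Z'_bound] mult_mono simp: powr_sum)

lemma norm_Z'_le:
  assumes "0 \<le> t" "t \<le> T"
  shows "norm (Z' t) \<le> N"
  using norm_triangle_mono[OF Z'_0_bound Z'_diff_le[of 0 t T]] assms by (simp add: deriv_bound_def)

lemma norm_Z'_X_le:
  assumes "0 \<le> u" "u \<le> T" "0 \<le> s" "s \<le> t" "t \<le> T" "t - s \<le> h"
  shows "norm (Z' u (X s t)) \<le> N * (a * h powr \<alpha>)"
  using X_le[OF assms(3-6)] norm_Z'_le[OF assms(1,2)] bounds_nonneg[OF nonneg]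
  by (intro order_trans[OF norm_blinfun] mult_mono) auto

lemma increment_le:
  assumes "0 \<le> s" "s \<le> t" "t \<le> T" "t - s \<le> h" "h \<le> T"
  shows "norm (Z t - Z s) \<le> N\<^sub>Z * h powr \<alpha>"
proof -
  have "norm ((Z t - Z s - Z' s (X s t)) + Z' s (X s t)) \<le> c * (h powr \<alpha> * h powr \<alpha>) + N * (a * h powr \<alpha>)"
    using assms by (intro norm_triangle_mono remainder_le norm_Z'_X_le) auto
  \<comment> \<open>One of the two factors is traded for a power of T, as the remainder is better
    than \<alpha>-Hoelder.\<close>
  also have "c * (h powr \<alpha> * h powr \<alpha>) \<le> c * (T powr \<alpha> * h powr \<alpha>)"
    using assms nonneg by (intro mult_left_mono mult_right_mono powr_le) auto
  finally show ?thesis by (simp add: path_bound_def algebra_simps)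
qed

lemma square_tens: "square u (tensV x y) = tensW (Z' u x) (Z' u y)"
  unfolding square_def
  by (rule V.tensor_ext_tens[OF W.bounded_bilinear_by_tens_comp[OF order_refl order_refl]])

lemma norm_square_le:
  assumes "0 \<le> u" "u \<le> T"
  shows "norm (square u p) \<le> N * N * norm p"
  unfolding square_def using norm_Z'_le[OF assms]
  by (intro V.norm_tensor_ext_le W.bounded_bilinear_by_tens_comp)

lemma norm_square_diff_le:
  assumes "0 \<le> u" "u \<le> m" "m \<le> T" "m - u \<le> h"
  shows "norm ((square u - square m) p) \<le> 2 * N * c * h powr \<alpha> * norm p"
proof -
  have N: "norm (Z' u) \<le> N" "norm (Z' m) \<le> N" using norm_Z'_le assms by auto
  have D: "norm (Z' u - Z' m) \<le> c * h powr \<alpha>"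
    using Z'_diff_le[OF assms] by (simp add: norm_minus_commute)
  have "square u - square m =
      tensor_ext tensV (\<lambda>x y. tensW (Z' u x) (Z' u y) - tensW (Z' m x) (Z' m y))"
    unfolding square_def
    by (rule V.tensor_ext_diff[symmetric])
      (rule W.bounded_bilinear_by_tens_comp[OF order_refl order_refl])+
  \<comment> \<open>Product rule: P \<otimes> P - Q \<otimes> Q = (P - Q) \<otimes> P + Q \<otimes>
    (P - Q), each summand containing one increment of Z'.\<close>
  also have "(\<lambda>x y. tensW (Z' u x) (Z' u y) - tensW (Z' m x) (Z' m y)) =
      (\<lambda>x y. tensW ((Z' u - Z' m) x) (Z' u y) + tensW (Z' m x) ((Z' u - Z' m) y))"
    by (simp add: blinfun.diff_left W.tens.diff_left W.tens.diff_right)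
  finally have "norm ((square u - square m) p) \<le> (c * h powr \<alpha> * N + N * (c * h powr \<alpha>)) * norm p"
    using V.norm_tensor_ext_le[OF bounded_bilinear_by_add[OF
        W.bounded_bilinear_by_tens_comp[OF D N(1)] W.bounded_bilinear_by_tens_comp[OF N(2) D]]]
    by (simp only:)
  then show ?thesis by (simp add: algebra_simps)
qed

lemma germ_defect:
  assumes "0 \<le> u" "u \<le> m" "m \<le> v" "v \<le> T"
  shows "norm (germ s u v - germ s u m - germ s m v) \<le> defect_bound \<alpha> T a b c * (v - u) powr (3 * \<alpha>)"
proof -
  define p where "p = (v - u) powr \<alpha>"
  have p: "0 \<le> p" by (simp add: p_def)
  note nn = bounds_nonneg[OF nonneg, of \<alpha> T]
  let ?R = "Z m - Z u - Z' u (X u m)" and ?S = "Z v - Z m - Z' u (X m v)"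
  have "square u (XX u v) = square u (XX u m) + square u (XX m v) + tensW (Z' u (X u m)) (Z' u (X m v))"
    using chen[OF assms] by (simp add: blinfun.add_right square_tens)
  \<comment> \<open>Chen's cross term cancels the leading part of Z(u,m) \<otimes> Z(m,v); what is
    left contains a remainder of Z or an increment of Z'.\<close>
  then have "germ s u v - germ s u m - germ s m v =
      - tensW ?R (Z v - Z m) - tensW (Z' u (X u m)) ?S + (square u - square m) (XX m v)"
    by (simp add: germ_eq blinfun.diff_left W.tens.diff_left W.tens.diff_right)
  also have "norm \<dots> \<le> norm (tensW ?R (Z v - Z m)) + norm (tensW (Z' u (X u m)) ?S)
      + norm ((square u - square m) (XX m v))"
    by (smt (verit) norm_minus_cancel norm_triangle_ineq norm_triangle_ineq4)
  also have "\<dots> \<le> c * (p * p) * (N\<^sub>Z * p) + N * (a * p) * (c * (p * p) + c * p * (a * p))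
      + 2 * N * c * p * (a * (p * p))"
  proof (intro add_mono)
    show "norm (tensW ?R (Z v - Z m)) \<le> c * (p * p) * (N\<^sub>Z * p)"
      unfolding p_def using assms nonneg
      by (intro order_trans[OF W.norm_tens_le] mult_mono remainder_le increment_le) auto
    \<comment> \<open>\<open>?S\<close> uses the derivative at u over [m,v], so it is the genuine
      remainder from m plus a correction by the increment of Z'.\<close>
    have "?S = (Z v - Z m - Z' m (X m v)) + (Z' m - Z' u) (X m v)"
      by (simp add: blinfun.diff_left)
    also have "norm \<dots> \<le> c * (p * p) + c * p * (a * p)"
      unfolding p_def using assms nonneg
      by (intro norm_triangle_mono remainder_le order_trans[OF norm_blinfun] mult_mono Z'_diff_le X_le) auto
    finally have S: "norm ?S \<le> c * (p * p) + c * p * (a * p)" .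
    have "norm (Z' u (X u m)) \<le> N * (a * p)"
      unfolding p_def using assms by (intro norm_Z'_X_le) auto
    with S show "norm (tensW (Z' u (X u m)) ?S) \<le> N * (a * p) * (c * (p * p) + c * p * (a * p))"
      using nn nonneg p by (intro order_trans[OF W.norm_tens_le] mult_mono) auto
    have "norm ((square u - square m) (XX m v)) \<le> 2 * N * c * p * norm (XX m v)"
      unfolding p_def using assms by (intro norm_square_diff_le) auto
    also have "\<dots> \<le> 2 * N * c * p * (a * (p * p))"
      using XX_le[of m v "v - u"] assms nn nonneg p by (intro mult_left_mono) (auto simp: p_def)
    finally show "norm ((square u - square m) (XX m v)) \<le> 2 * N * c * p * (a * (p * p))" .
  qed
  also have "\<dots> = defect_bound \<alpha> T a b c * (p * p * p)"
    by (simp add: defect_bound_def algebra_simps)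
  finally show ?thesis by (simp add: powr_sum p_def)
qed

sublocale germ: almost_additive "germ s" T "defect_bound \<alpha> T a b c" "3 * \<alpha>" for s
  using alpha bounds_nonneg[OF nonneg] germ_defect by unfold_locales auto

lemma sew_const_eq_sewing_bound: "germ.sew_const = sewing_bound \<alpha> T a b c"
  by (simp add: germ.sew_const_def sewing_bound_def)

lemma ZZ_limit:
  assumes "0 \<le> s" "s \<le> t" "t \<le> T"
  shows "has_partition_limit (germ s) (ZZ s t) s t"
proof -
  obtain I where I: "has_partition_limit (germ s) I s t"
    using germ.sewing[OF assms] by blast
  then show ?thesis
    using partition_limit_eqI[OF I assms(2)] by (simp add: lift2_def)
qed

lemma ZZ_approx:
  assumes "0 \<le> s" "s \<le> t" "t \<le> T"
  shows "norm (ZZ s t - square s (XX s t)) \<le> sewing_bound \<alpha> T a b c * (t - s) powr (3 * \<alpha>)"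
proof -
  obtain I where "has_partition_limit (germ s) I s t"
    "norm (I - germ s s t) \<le> germ.sew_const * (t - s) powr (3 * \<alpha>)"
    using germ.sewing[OF assms, of s] by metis
  \<comment> \<open>With the base point at the left endpoint the product term vanishes.\<close>
  moreover have "germ s s t = square s (XX s t)"
    by (simp add: germ_eq W.tens.zero_left)
  ultimately show ?thesis
    using has_partition_limit_unique[OF ZZ_limit[OF assms] _ assms(2)]
    by (metis sew_const_eq_sewing_bound)
qed

lemma ZZ_chen:
  assumes "0 \<le> s" "s \<le> u" "u \<le> t" "t \<le> T"
  shows "ZZ s t = ZZ s u + ZZ u t + tensW (Z u - Z s) (Z t - Z u)"
proof -
  \<comment> \<open>The change of base point is itself an increment in the last two arguments, so
    its partition sums telescope.\<close>
  have "germ s = (\<lambda>r v. germ u r v + (tensW (Z u - Z s) (Z v) - tensW (Z u - Z s) (Z r)))"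
    by (simp add: fun_eq_iff germ_eq W.tens.diff_left W.tens.diff_right)
  moreover have "has_partition_limit \<dots> (ZZ u t + (tensW (Z u - Z s) (Z t) - tensW (Z u - Z s) (Z u))) u t"
    by (intro has_partition_limit_add has_partition_limit_increments ZZ_limit) (use assms in auto)
  ultimately have "has_partition_limit (germ s)
      (ZZ u t + (tensW (Z u - Z s) (Z t) - tensW (Z u - Z s) (Z u))) u t"
    by simp
  then have "ZZ s t = ZZ s u + (ZZ u t + (tensW (Z u - Z s) (Z t) - tensW (Z u - Z s) (Z u)))"
    by (rule has_partition_limit_combine[rotated]) (use assms ZZ_limit in auto)
  then show ?thesis by (simp add: W.tens.diff_right add.assoc)
qed

lemma sewing_bound_nonneg: "0 \<le> sewing_bound \<alpha> T a b c"
  using germ.sew_const_nonneg by (simp add: sew_const_eq_sewing_bound)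

lemma ZZ_bound:
  assumes "0 \<le> s" "s \<le> t" "t \<le> T"
  shows "norm (ZZ s t) \<le> (N * N * a + sewing_bound \<alpha> T a b c * T powr \<alpha>) * (t - s) powr (2 * \<alpha>)"
proof -
  define p where "p = (t - s) powr \<alpha>"
  have "norm (square s (XX s t)) \<le> N * N * (a * (p * p))"
    unfolding p_def using assms bounds_nonneg[OF nonneg]
    by (intro order_trans[OF norm_square_le] mult_mono XX_le) auto
  moreover have "norm (ZZ s t - square s (XX s t)) \<le> sewing_bound \<alpha> T a b c * (p * p * p)"
    using ZZ_approx[OF assms] by (simp add: powr_sum p_def)
  moreover have "sewing_bound \<alpha> T a b c * (p * p * p) \<le> sewing_bound \<alpha> T a b c * (p * p * T powr \<alpha>)"
    unfolding p_def using assms sewing_bound_nonneg by (intro mult_left_mono powr_le) auto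
  ultimately have "norm ((ZZ s t - square s (XX s t)) + square s (XX s t))
      \<le> sewing_bound \<alpha> T a b c * (p * p * T powr \<alpha>) + N * N * (a * (p * p))"
    by (intro norm_triangle_mono) auto
  then show ?thesis
    unfolding powr_sum p_def[symmetric] by (simp add: algebra_simps)
qed

lemma increments_bound:
  assumes "0 \<le> s" "s \<le> t" "t \<le> T"
  shows "norm (increments Z s t) \<le> N\<^sub>Z * (t - s) powr \<alpha>"
  using increment_le[OF assms order_refl] assms by (simp add: increments_def)

lemma rough_path_lift: "rough_path tensW \<alpha> T (increments Z) ZZ"
proof -
  have "holder_finite T \<alpha> (increments Z)" "holder_finite T (2 * \<alpha>) ZZ"
    by (rule holder_finiteI[OF increments_bound] holder_finiteI[OF ZZ_bound]; assumption)+
  then show ?thesis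
    unfolding rough_path_def using ZZ_chen by (auto simp: increments_def)
qed

lemma rough_norm_lift: "rough_norm \<alpha> T (increments Z) ZZ \<le> lift_bound \<alpha> T a b c"
  unfolding rough_norm_def lift_bound_def
  by (intro add_mono holder_norm_leI increments_bound ZZ_bound T_pos)

end

section \<open>Equivalence of the two equations\<close>

lemma blinfun_apply_fderiv:
  assumes "F differentiable (at y)"
  shows "(F has_derivative blinfun_apply (fderiv F y)) (at y)"
proof -
  have D: "(F has_derivative frechet_derivative F (at y)) (at y)"
    using assms by (simp add: frechet_derivative_works)
  then show ?thesis
    unfolding fderiv_def by (simp add: bounded_linear_Blinfun_apply has_derivative_bounded_linear)
qed

lemma C3b_bounds:
  fixes F :: "'a::banach \<Rightarrow> 'b::banach"
  assumes "C3b F"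
  obtains \<beta> where "0 \<le> \<beta>" "\<And>y. norm (F y) \<le> \<beta>" "\<And>y. norm (fderiv F y) \<le> \<beta>"
    "\<And>x y. norm (F x - F y) \<le> \<beta> * norm (x - y)"
proof -
  obtain \<beta>0 \<beta>1 where b: "\<And>y. norm (F y) \<le> \<beta>0" "\<And>y. norm (fderiv F y) \<le> \<beta>1"
    using assms unfolding C3b_def bounded_iff by auto
  define \<beta> where "\<beta> = max \<beta>0 \<beta>1"
  have le: "norm (F y) \<le> \<beta>" "norm (fderiv F y) \<le> \<beta>" for y
    using b[of y] by (auto simp: \<beta>_def)
  have "norm (F x - F y) \<le> \<beta> * norm (x - y)" for x y
  proof (rule differentiable_bound[OF convex_UNIV])
    fix z
    show "(F has_derivative blinfun_apply (fderiv F z)) (at z within UNIV)"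
      using assms by (auto simp: C3b_def intro: blinfun_apply_fderiv)
    show "onorm (blinfun_apply (fderiv F z)) \<le> \<beta>"
      using le(2)[of z] by (simp add: norm_blinfun.rep_eq)
  qed auto
  moreover have "0 \<le> \<beta>" using le(1) norm_ge_zero order_trans by blast
  ultimately show thesis using that le by blast
qed

lemma norm_blinfun_compose_le:
  assumes "norm f \<le> p" "norm g \<le> q"
  shows "norm (f o\<^sub>L g) \<le> p * q"
proof -
  have "norm f * norm g \<le> p * q"
    using assms by (intro mult_mono) (auto intro: order_trans[OF norm_ge_zero])
  then show ?thesis using norm_blinfun_compose[of f g] by linarith
qed

lemma norm_blinfun_apply_le:
  assumes "norm f \<le> p" "norm x \<le> q"
  shows "norm (blinfun_apply f x) \<le> p * q"
proof -
  have "norm f * norm x \<le> p * q"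
    using assms by (intro mult_mono) (auto intro: order_trans[OF norm_ge_zero])
  then show ?thesis using norm_blinfun[of f x] by linarith
qed

text \<open>Closeness is symmetric, so existence of the limit transfers both ways along with its
  value.\<close>

lemma has_partition_limit_cong:
  assumes "\<And>u v. s \<le> u \<Longrightarrow> u < v \<Longrightarrow> v \<le> t \<Longrightarrow> norm (B u v - A u v) \<le> K * (v - u) powr \<theta>" "1 < \<theta>"
  shows "has_partition_limit A I s t \<longleftrightarrow> has_partition_limit B I s t"
proof
  show "has_partition_limit A I s t \<Longrightarrow> has_partition_limit B I s t"
    by (rule has_partition_limit_close[OF _ assms(2,1)])
  show "has_partition_limit B I s t \<Longrightarrow> has_partition_limit A I s t"
    by (rule has_partition_limit_close[where K = K and \<theta> = \<theta>])
      (use assms in \<open>auto simp: norm_minus_commute\<close>)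
qed

context controlled_rough_path
begin

lemma X_same:
  assumes "0 \<le> s" "s \<le> T"
  shows "X s s = 0"
  using X_additive[OF assms(1) order_refl order_refl assms(2)] by simp

text \<open>The first-level terms coincide. Writing Y' = F(Y) Z' makes the second-level terms the
  same operator, the extension of \<open>B\<close>, applied to ZZ and to its leading part, so
  \<open>ZZ_approx\<close> gives the bound.\<close>

lemma rde_germ_close:
  fixes F :: "'u::banach \<Rightarrow> 'w \<Rightarrow>\<^sub>L 'u"
  assumes F: "norm (F (Y u)) \<le> \<beta>" "norm (fderiv F (Y u)) \<le> \<beta>" "0 \<le> \<beta>"
    and Y': "Y' u = F (Y u) o\<^sub>L Z' u"
    and uv: "0 \<le> u" "u \<le> v" "v \<le> T"
  shows "norm (rde_germ tensW (increments Z) ZZ F Y u v -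
      controlled_germ tensV XX Z Z' (\<lambda>u. F (Y u)) (\<lambda>u. fderiv F (Y u) o\<^sub>L Y' u) u v)
    \<le> \<beta> * \<beta> * sewing_bound \<alpha> T a b c * (v - u) powr (3 * \<alpha>)"
proof -
  define B where "B = (\<lambda>w1 w2. blinfun_apply (fderiv F (Y u) (F (Y u) w1)) w2)"
  have "B = (\<lambda>w1 w2. blinfun_apply (blinfun_apply (fderiv F (Y u) o\<^sub>L F (Y u)) w1) w2)"
    by (simp add: B_def)
  then have B: "bounded_bilinear_by B (norm (fderiv F (Y u) o\<^sub>L F (Y u)))"
    by (simp only: bounded_bilinear_by_blinfun)
  have G: "norm (fderiv F (Y u) o\<^sub>L F (Y u)) \<le> \<beta> * \<beta>"
    by (rule norm_blinfun_compose_le[OF F(2,1)])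
  have "controlled_germ tensV XX Z Z' (\<lambda>u. F (Y u)) (\<lambda>u. fderiv F (Y u) o\<^sub>L Y' u) u v
      = F (Y u) (increments Z u v) + tensor_ext tensV (\<lambda>x y. B (Z' u x) (Z' u y)) (XX u v)"
    by (simp add: controlled_germ_def Y' B_def)
  also have "\<dots> = F (Y u) (increments Z u v) + tensor_ext tensW B (square u (XX u v))"
    using tensor_ext_comp[OF V.projective_tensor_product_axioms W.projective_tensor_product_axioms B, of "Z' u"]
    by (simp add: square_def)
  finally have "rde_germ tensW (increments Z) ZZ F Y u v -
      controlled_germ tensV XX Z Z' (\<lambda>u. F (Y u)) (\<lambda>u. fderiv F (Y u) o\<^sub>L Y' u) u v
      = tensor_ext tensW B (ZZ u v - square u (XX u v))"
    by (simp add: rde_germ_def B_def blinfun.diff_right)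
  also have "norm \<dots> \<le> norm (fderiv F (Y u) o\<^sub>L F (Y u)) * norm (ZZ u v - square u (XX u v))"
    by (rule W.norm_tensor_ext_le[OF B])
  also have "\<dots> \<le> \<beta> * \<beta> * (sewing_bound \<alpha> T a b c * (v - u) powr (3 * \<alpha>))"
    using G ZZ_approx[OF uv] F(3) by (intro mult_mono) auto
  finally show ?thesis by (simp add: mult.assoc)
qed

lemma integral_equations_iff:
  fixes F :: "'u::banach \<Rightarrow> 'w \<Rightarrow>\<^sub>L 'u"
  assumes "\<And>y. norm (F y) \<le> \<beta>" "\<And>y. norm (fderiv F y) \<le> \<beta>" "0 \<le> \<beta>"
    and "\<forall>t\<in>{0..T}. Y' t = F (Y t) o\<^sub>L Z' t" and "t \<in> {0..T}"
  shows "has_partition_limit (controlled_germ tensV XX Z Z' (\<lambda>u. F (Y u)) (\<lambda>u. fderiv F (Y u) o\<^sub>L Y' u)) I 0 t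
    \<longleftrightarrow> has_partition_limit (rde_germ tensW (increments Z) ZZ F Y) I 0 t"
proof (rule has_partition_limit_cong)
  fix u v assume "0 \<le> u" "u < v" "v \<le> t"
  then show "norm (rde_germ tensW (increments Z) ZZ F Y u v -
      controlled_germ tensV XX Z Z' (\<lambda>u. F (Y u)) (\<lambda>u. fderiv F (Y u) o\<^sub>L Y' u) u v)
    \<le> \<beta> * \<beta> * sewing_bound \<alpha> T a b c * (v - u) powr (3 * \<alpha>)"
    using assms by (intro rde_germ_close) auto
qed (use alpha in simp)

text \<open>The new remainder is the old one minus F(Y) applied to the remainder of Z. The expansion
  of Y along X also shows that Y is \<alpha>-Hoelder, and the Lipschitz bound passes this on to
  F(Y).\<close>

lemma controlled_lift_if_controlled:
  fixes F :: "'u::banach \<Rightarrow> 'w \<Rightarrow>\<^sub>L 'u"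
  assumes F: "\<And>y. norm (F y) \<le> \<beta>" "\<And>x y. norm (F x - F y) \<le> \<beta> * norm (x - y)" "0 \<le> \<beta>"
    and Y': "\<forall>t\<in>{0..T}. Y' t = F (Y t) o\<^sub>L Z' t"
    and Y: "controlled \<alpha> T X Y Y'"
  shows "controlled \<alpha> T (increments Z) Y (\<lambda>t. F (Y t))"
proof -
  define e where "e = holder_norm T (2 * \<alpha>) (remainder0 X Y Y')"
  have fin: "holder_finite T (2 * \<alpha>) (remainder0 X Y Y')"
    using Y by (simp add: controlled_def)
  have e: "0 \<le> e" unfolding e_def by (rule holder_norm_nonneg[OF T_pos fin])
  have rem: "norm (Y t - Y s - F (Y s) (Z' s (X s t))) \<le> e * (t - s) powr (2 * \<alpha>)"
    if "0 \<le> s" "s \<le> t" "t \<le> T" for s t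
    using holder_normD[OF fin that] that Y'
    by (simp add: e_def remainder0_def increments_def X_same blinfun.zero_right)
  have "norm (remainder0 (increments Z) Y (\<lambda>t. F (Y t)) s t) \<le> (e + \<beta> * c) * (t - s) powr (2 * \<alpha>)"
    if st: "0 \<le> s" "s \<le> t" "t \<le> T" for s t
  proof -
    have "remainder0 (increments Z) Y (\<lambda>t. F (Y t)) s t =
        (Y t - Y s - F (Y s) (Z' s (X s t))) - F (Y s) (Z t - Z s - Z' s (X s t))"
      by (simp add: remainder0_def increments_def blinfun.diff_right)
    also have "norm \<dots> \<le> e * (t - s) powr (2 * \<alpha>) + \<beta> * (c * (t - s) powr (2 * \<alpha>))"
      by (intro norm_triangle_le_diff add_mono rem norm_blinfun_apply_le F remainder_bound st)
    finally show ?thesis by (simp add: algebra_simps)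
  qed
  moreover have "norm (increments (\<lambda>t. F (Y t)) s t) \<le> (\<beta> * (e * T powr \<alpha> + \<beta> * (N * a))) * (t - s) powr \<alpha>"
    if st: "0 \<le> s" "s \<le> t" "t \<le> T" for s t
  proof -
    define p where "p = (t - s) powr \<alpha>"
    have "e * (p * p) \<le> e * (T powr \<alpha> * p)"
      unfolding p_def using st e by (intro mult_left_mono mult_right_mono powr_le) auto
    moreover have "norm ((Y t - Y s - F (Y s) (Z' s (X s t))) + F (Y s) (Z' s (X s t)))
        \<le> e * (p * p) + \<beta> * (N * (a * p))"
      unfolding p_def using st
      by (intro norm_triangle_mono norm_blinfun_apply_le F norm_Z'_X_le)
        (use rem[OF st] in \<open>simp_all add: powr_sum\<close>)
    ultimately have "norm (Y t - Y s) \<le> e * (T powr \<alpha> * p) + \<beta> * (N * (a * p))" by simp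
    then have "\<beta> * norm (Y t - Y s) \<le> \<beta> * (e * (T powr \<alpha> * p) + \<beta> * (N * (a * p)))"
      using F(3) by (rule mult_left_mono)
    with F(2)[of "Y t" "Y s"] show ?thesis
      unfolding p_def[symmetric] by (simp add: increments_def algebra_simps)
  qed
  ultimately show ?thesis
    unfolding controlled_def by (blast intro: holder_finiteI)
qed

text \<open>Now the remainder of Z is added back. Hoelder continuity of F(Y) is part of the
  hypothesis, and a product rule yields that of F(Y) Z'.\<close>

lemma controlled_if_controlled_lift:
  fixes F :: "'u::banach \<Rightarrow> 'w \<Rightarrow>\<^sub>L 'u"
  assumes F: "\<And>y. norm (F y) \<le> \<beta>" "0 \<le> \<beta>"
    and Y: "controlled \<alpha> T (increments Z) Y (\<lambda>t. F (Y t))"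
  shows "controlled \<alpha> T X Y (\<lambda>t. F (Y t) o\<^sub>L Z' t)"
proof -
  define e where "e = holder_norm T (2 * \<alpha>) (remainder0 (increments Z) Y (\<lambda>t. F (Y t)))"
  define f where "f = holder_norm T \<alpha> (increments (\<lambda>t. F (Y t)))"
  have fin: "holder_finite T (2 * \<alpha>) (remainder0 (increments Z) Y (\<lambda>t. F (Y t)))"
    "holder_finite T \<alpha> (increments (\<lambda>t. F (Y t)))"
    using Y by (simp_all add: controlled_def)
  have rem: "norm (Y t - Y s - F (Y s) (Z t - Z s)) \<le> e * (t - s) powr (2 * \<alpha>)"
    and inc: "norm (F (Y t) - F (Y s)) \<le> f * (t - s) powr \<alpha>"
    if "0 \<le> s" "s \<le> t" "t \<le> T" for s t
    using holder_normD[OF fin(1) that] holder_normD[OF fin(2) that]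
    by (simp_all add: e_def f_def remainder0_def increments_def blinfun.zero_right)
  have "norm (remainder0 X Y (\<lambda>t. F (Y t) o\<^sub>L Z' t) s t) \<le> (e + \<beta> * c) * (t - s) powr (2 * \<alpha>)"
    if st: "0 \<le> s" "s \<le> t" "t \<le> T" for s t
  proof -
    have "remainder0 X Y (\<lambda>t. F (Y t) o\<^sub>L Z' t) s t =
        (Y t - Y s - F (Y s) (Z t - Z s)) + F (Y s) (Z t - Z s - Z' s (X s t))"
      by (simp add: remainder0_def increments_def blinfun.diff_right)
    also have "norm \<dots> \<le> e * (t - s) powr (2 * \<alpha>) + \<beta> * (c * (t - s) powr (2 * \<alpha>))"
      by (intro norm_triangle_mono rem norm_blinfun_apply_le F remainder_bound st)
    finally show ?thesis by (simp add: algebra_simps)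
  qed
  moreover have "norm (increments (\<lambda>t. F (Y t) o\<^sub>L Z' t) s t) \<le> (f * N + \<beta> * c) * (t - s) powr \<alpha>"
    if st: "0 \<le> s" "s \<le> t" "t \<le> T" for s t
  proof -
    have "increments (\<lambda>t. F (Y t) o\<^sub>L Z' t) s t =
        ((F (Y t) - F (Y s)) o\<^sub>L Z' t) + (F (Y s) o\<^sub>L (Z' t - Z' s))"
      by (rule blinfun_eqI) (simp add: increments_def blinfun.bilinear_simps)
    also have "norm \<dots> \<le> (f * (t - s) powr \<alpha>) * N + \<beta> * (c * (t - s) powr \<alpha>)"
      using st by (intro norm_triangle_mono norm_blinfun_compose_le inc norm_Z'_le F Z'_bound) auto
    finally show ?thesis by (simp add: algebra_simps)
  qed
  ultimately show ?thesis
    unfolding controlled_def by (blast intro: holder_finiteI)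
qed

lemma solutions_iff:
  fixes F :: "'u::banach \<Rightarrow> 'w \<Rightarrow>\<^sub>L 'u"
  assumes "C3b F"
  shows "(\<exists>Y'. controlled_solution tensV \<alpha> T X XX Z Z' F Y Y') \<longleftrightarrow>
    rde_solution tensW \<alpha> T (increments Z) ZZ F Y"
proof -
  obtain \<beta> where F: "0 \<le> \<beta>" "\<And>y. norm (F y) \<le> \<beta>" "\<And>y. norm (fderiv F y) \<le> \<beta>"
    "\<And>x y. norm (F x - F y) \<le> \<beta> * norm (x - y)"
    using C3b_bounds[OF assms] by blast
  show ?thesis
  proof
    assume "\<exists>Y'. controlled_solution tensV \<alpha> T X XX Z Z' F Y Y'"
    then obtain Y' where Y: "controlled_solution tensV \<alpha> T X XX Z Z' F Y Y'" ..
    then have Y': "\<forall>t\<in>{0..T}. Y' t = F (Y t) o\<^sub>L Z' t" by (simp add: controlled_solution_def)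
    show "rde_solution tensW \<alpha> T (increments Z) ZZ F Y"
      using Y controlled_lift_if_controlled[OF F(2,4,1) Y']
      unfolding rde_solution_def controlled_solution_def
      by (auto simp: integral_equations_iff[OF F(2,3,1) Y'])
  next
    assume Y: "rde_solution tensW \<alpha> T (increments Z) ZZ F Y"
    have Y': "\<forall>t\<in>{0..T}. F (Y t) o\<^sub>L Z' t = F (Y t) o\<^sub>L Z' t" by simp
    \<comment> \<open>On [0,T] the definition of a controlled solution admits no other
      derivative.\<close>
    have "controlled_solution tensV \<alpha> T X XX Z Z' F Y (\<lambda>t. F (Y t) o\<^sub>L Z' t)"
      using Y controlled_if_controlled_lift[OF F(2,1)]
      unfolding rde_solution_def controlled_solution_def
      by (auto simp: integral_equations_iff[OF F(2,3,1) Y', simplified])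
    then show "\<exists>Y'. controlled_solution tensV \<alpha> T X XX Z Z' F Y Y'"
      by blast
  qed
qed

end

text \<open>Takes the norms themselves as majorants; each seminorm is at most the sum it belongs to,
  since the other one is nonnegative.\<close>

lemma controlled_rough_pathI:
  assumes "1 / 3 < \<alpha>" "0 < T" "projective_tensor tensV" "projective_tensor tensW"
    and X: "rough_path tensV \<alpha> T X XX" and Z: "controlled \<alpha> T X Z Z'"
  shows "controlled_rough_path tensV tensW \<alpha> T (rough_norm \<alpha> T X XX) (norm (Z' 0))
    (controlled_norm \<alpha> T X Z Z') X XX Z Z'"
proof -
  interpret V: projective_tensor_product tensV by unfold_locales fact
  interpret W: projective_tensor_product tensW by unfold_locales fact
  have fin: "holder_finite T \<alpha> X" "holder_finite T (2 * \<alpha>) XX"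
    "holder_finite T (2 * \<alpha>) (remainder0 X Z Z')" "holder_finite T \<alpha> (increments Z')"
    using X Z by (auto simp: rough_path_def controlled_def)
  note nn = fin[THEN holder_norm_nonneg[OF assms(2)]]
  have additive: "X s t = X s u + X u t" "XX s t = XX s u + XX u t + tensV (X s u) (X u t)"
    if "0 \<le> s" "s \<le> u" "u \<le> t" "t \<le> T" for s u t
    using X that unfolding rough_path_def by blast+
  \<comment> \<open>Chen's relation at coinciding times; \<open>holder_normD\<close> needs these
    diagonal values.\<close>
  have same: "X s s = 0" "XX s s = 0" if "0 \<le> s" "s \<le> T" for s
    using additive[OF that(1) order_refl order_refl that(2)] by (simp_all add: V.tens.zero_left)
  show ?thesis
  proof unfold_locales
    fix s t assume st: "0 \<le> s" "s \<le> t" "t \<le> T"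
    have weaken: "holder_norm T \<gamma> A * (t - s) powr \<gamma> \<le> K * (t - s) powr \<gamma>"
      if "holder_norm T \<gamma> A \<le> K" for \<gamma> K and A :: "real \<Rightarrow> real \<Rightarrow> 'e::real_normed_vector"
      using that by (rule mult_right_mono) simp
    show "norm (X s t) \<le> rough_norm \<alpha> T X XX * (t - s) powr \<alpha>"
      by (rule order_trans[OF holder_normD[OF fin(1) st] weaken])
        (use nn same st in \<open>auto simp: rough_norm_def\<close>)
    show "norm (XX s t) \<le> rough_norm \<alpha> T X XX * (t - s) powr (2 * \<alpha>)"
      by (rule order_trans[OF holder_normD[OF fin(2) st] weaken])
        (use nn same st in \<open>auto simp: rough_norm_def\<close>)
    show "norm (Z t - Z s - Z' s (X s t)) \<le> controlled_norm \<alpha> T X Z Z' * (t - s) powr (2 * \<alpha>)"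
      unfolding remainder0_def[of X Z Z', unfolded increments_def, symmetric]
      by (rule order_trans[OF holder_normD[OF fin(3) st] weaken])
        (use nn same st in \<open>auto simp: controlled_norm_def remainder0_def increments_def blinfun.zero_right\<close>)
    show "norm (Z' t - Z' s) \<le> controlled_norm \<alpha> T X Z Z' * (t - s) powr \<alpha>"
      unfolding increments_def[of Z', symmetric]
      by (rule order_trans[OF holder_normD[OF fin(4) st] weaken])
        (use nn in \<open>auto simp: controlled_norm_def increments_def\<close>)
  next
    fix s u t assume "0 \<le> s" "s \<le> u" "u \<le> t" "t \<le> T"
    from additive[OF this]
    show "X s t = X s u + X u t" "XX s t = XX s u + XX u t + tensV (X s u) (X u t)" .
  qed (use assms(1,2) nn in \<open>auto simp: rough_norm_def controlled_norm_def\<close>)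
qed

theorem theorem3p11:
  fixes \<alpha> :: real
    and tensV :: "'v::banach \<Rightarrow> 'v \<Rightarrow> 'vv::banach"
    and tensW :: "'w::banach \<Rightarrow> 'w \<Rightarrow> 'ww::banach"
  assumes "1 / 3 < \<alpha>" and "\<alpha> \<le> 1 / 2"
    and "projective_tensor tensV" and "projective_tensor tensW"
  shows
    "\<exists>M :: real \<Rightarrow> real \<Rightarrow> real \<Rightarrow> real \<Rightarrow> real.
       (\<forall>T T' a a' b b' c c'. 0 \<le> T \<and> T \<le> T' \<and> 0 \<le> a \<and> a \<le> a' \<and> 0 \<le> b \<and> b \<le> b' \<and> 0 \<le> c \<and> c \<le> c'
          \<longrightarrow> M T a b c \<le> M T' a' b' c') \<and>
       (\<forall>T X XX Z (Z' :: real \<Rightarrow> 'v \<Rightarrow>\<^sub>L 'w).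
          0 < T \<and> rough_path tensV \<alpha> T X XX \<and> controlled \<alpha> T X Z Z' \<longrightarrow>
          (\<forall>s t. 0 \<le> s \<and> s \<le> t \<and> t \<le> T \<longrightarrow>
             has_partition_limit (lift_germ tensV tensW XX Z Z' s)
               (lift2 tensV tensW XX Z Z' s t) s t) \<and>
          rough_path tensW \<alpha> T (increments Z) (lift2 tensV tensW XX Z Z') \<and>
          rough_norm \<alpha> T (increments Z) (lift2 tensV tensW XX Z Z')
            \<le> M T (rough_norm \<alpha> T X XX) (norm (Z' 0)) (controlled_norm \<alpha> T X Z Z') \<and>
          (\<forall>(F :: 'u::banach \<Rightarrow> 'w \<Rightarrow>\<^sub>L 'u) Y. C3b F \<longrightarrow>
             ((\<exists>Y'. controlled_solution tensV \<alpha> T X XX Z Z' F Y Y') \<longleftrightarrow>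
              rde_solution tensW \<alpha> T (increments Z) (lift2 tensV tensW XX Z Z') F Y)))"
proof (intro exI[of _ "lift_bound \<alpha>"] conjI allI impI)
  fix T T' a a' b b' c c' :: real
  assume "0 \<le> T \<and> T \<le> T' \<and> 0 \<le> a \<and> a \<le> a' \<and> 0 \<le> b \<and> b \<le> b' \<and> 0 \<le> c \<and> c \<le> c'"
  then show "lift_bound \<alpha> T a b c \<le> lift_bound \<alpha> T' a' b' c'"
    using assms(1) by (intro lift_bound_mono) auto
next
  fix T X XX Z and Z' :: "real \<Rightarrow> 'v \<Rightarrow>\<^sub>L 'w"
  assume "0 < T \<and> rough_path tensV \<alpha> T X XX \<and> controlled \<alpha> T X Z Z'"
  \<comment> \<open>\<open>lift_bound \<alpha>\<close> was fixed before T and the paths, so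
    evaluating it at their norms gives a universal bound.\<close>
  then interpret controlled_rough_path tensV tensW \<alpha> T "rough_norm \<alpha> T X XX" "norm (Z' 0)"
      "controlled_norm \<alpha> T X Z Z'" X XX Z Z'
    using assms by (intro controlled_rough_pathI) auto
  show "has_partition_limit (lift_germ tensV tensW XX Z Z' s) (lift2 tensV tensW XX Z Z' s t) s t"
    if "0 \<le> s \<and> s \<le> t \<and> t \<le> T" for s t
    using that by (intro ZZ_limit) auto
  show "rough_path tensW \<alpha> T (increments Z) (lift2 tensV tensW XX Z Z')"
    by (rule rough_path_lift)
  show "rough_norm \<alpha> T (increments Z) (lift2 tensV tensW XX Z Z')
      \<le> lift_bound \<alpha> T (rough_norm \<alpha> T X XX) (norm (Z' 0)) (controlled_norm \<alpha> T X Z Z')"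
    by (rule rough_norm_lift)
  show "(\<exists>Y'. controlled_solution tensV \<alpha> T X XX Z Z' F Y Y') \<longleftrightarrow>
      rde_solution tensW \<alpha> T (increments Z) (lift2 tensV tensW XX Z Z') F Y"
    if "C3b F" for F :: "'u \<Rightarrow> 'w \<Rightarrow>\<^sub>L 'u" and Y
    using that by (rule solutions_iff)
qed

end
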